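(* The following are equivalent: (1) $\mathfrak d=\mathrm{cov}(\mathcal M)$. (2) For every Boolean subalgebra $\mathbb B\subseteq\mathcal P(\omega)$ with $[\omega]^{<\omega}\subseteq\mathbb B$ and every finitely additive measure $\mu:\mathbb B\to[0,1]$ vanishing on finite sets such that $\mathbb B$ has density less than $\mathfrak d$, there exists an atomless strong $Q$-measure $\nu:\mathcal P(\omega)\to[0,1]$ extending $\mu$ (i.e. $\nu\restriction\mathbb B=\mu$).
   Context: $\mathfrak d$ is the dominating number (least size of a family $\mathcal D\subseteq\omega^\omega$ such that every $f\in\omega^\omega$ is eventually strictly dominated by some $g\in\mathcal D$), and $\mathrm{cov}(\mathcal M)$ is the least size of a family of meager subsets of $2^\omega$ covering $2^\omega$. The density of a Boolean algebra $\mathbb B\subseteq\mathcal P(\omega)$ is the least cardinality of a family $\mathcal A$ of infinite elements of $\mathbb B$ such that every infinite $B\in\mathbb B$ contains some $A\in\mathcal A$. A measure $\nu$ is atomless if for every $A$ with $\nu(A)>0$ there is $B\subseteq A$ with $0<\nu(B)<\nu(A)$. A finitely additive measure $\nu:\mathcal P(\omega)\to[0,1]$ vanishing on finite sets is a strong $Q$-measure if for every partition $\{A_n:n\in\omega\}$ of $\omega$ into finite sets there is $A\subseteq\omega$ with $\nu(A)\ge\nu(\omega)$ and $|A\cap A_n|\le1$ for all $n$. *)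

theory Defs
  imports "HOL-Analysis.Analysis"
begin

no_notation elt_set_eq (infix "=o" 50)
unbundle cardinal_syntax

text \<open>
  Cardinal invariants are cardinals in the sense of the library's cardinal orders, compared across
  types by \<^term>\<open>(=o)\<close> and \<^term>\<open>(<o)\<close>. The value below is the least cardinality of a member of
  \<open>\<F>\<close>, unspecified when \<open>\<F>\<close> is empty; the families it is applied to are shown to be nonempty.
\<close>

definition least_card :: "'a set set \<Rightarrow> 'a rel" where
  "least_card \<F> = (SOME r. r \<in> card_of ` \<F> \<and> (\<forall>D\<in>\<F>. r \<le>o |D| ))"

lemma least_card:
  assumes "\<F> \<noteq> {}"
  shows "\<exists>D\<in>\<F>. least_card \<F> = |D|" and "D \<in> \<F> \<Longrightarrow> least_card \<F> \<le>o |D|"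
proof -
  have "\<exists>r. r \<in> card_of ` \<F> \<and> (\<forall>D\<in>\<F>. r \<le>o |D| )"
    using exists_minim_Card_order[of "card_of ` \<F>"] assms
    by (simp add: Bex_def image_iff) (metis card_of_Card_order)
  then have *: "least_card \<F> \<in> card_of ` \<F> \<and> (\<forall>D\<in>\<F>. least_card \<F> \<le>o |D| )"
    unfolding least_card_def by (rule someI_ex)
  from * show "\<exists>D\<in>\<F>. least_card \<F> = |D|" by auto
  from * show "D \<in> \<F> \<Longrightarrow> least_card \<F> \<le>o |D|" by auto
qed

definition dominating :: "(nat \<Rightarrow> nat) set \<Rightarrow> bool" where
  "dominating D \<longleftrightarrow> (\<forall>f. \<exists>g\<in>D. eventually (\<lambda>n. f n < g n) sequentially)"

definition dominating_number :: "(nat \<Rightarrow> nat) rel" where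
  "dominating_number = least_card {D. dominating D}"

lemma dominating_UNIV: "dominating UNIV"
  unfolding dominating_def
proof
  fix f :: "nat \<Rightarrow> nat"
  have "eventually (\<lambda>n. f n < Suc (f n)) sequentially" by simp
  then show "\<exists>g\<in>UNIV. eventually (\<lambda>n. f n < g n) sequentially"
    by (intro bexI[of _ "\<lambda>n. Suc (f n)"] UNIV_I)
qed

definition nowhere_dense :: "'a::topological_space set \<Rightarrow> bool" where
  "nowhere_dense S \<longleftrightarrow> interior (closure S) = {}"

definition meager :: "'a::topological_space set \<Rightarrow> bool" where
  "meager S \<longleftrightarrow> (\<exists>N :: nat \<Rightarrow> 'a set. (\<forall>n. nowhere_dense (N n)) \<and> S = (\<Union>n. N n))"

text \<open>
  The Cantor space is the type \<^typ>\<open>nat \<Rightarrow> bool\<close> with the library's topology, i.e.\ the product of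
  discrete topologies.
\<close>

definition meager_cover :: "(nat \<Rightarrow> bool) set set \<Rightarrow> bool" where
  "meager_cover \<F> \<longleftrightarrow> (\<forall>M\<in>\<F>. meager M) \<and> \<Union>\<F> = UNIV"

definition cov_meager :: "(nat \<Rightarrow> bool) set rel" where
  "cov_meager = least_card {\<F>. meager_cover \<F>}"

lemma ex_meager_cover: "\<exists>\<F>. meager_cover \<F>"
proof -
  have "nowhere_dense {x :: nat \<Rightarrow> bool}" for x
  proof -
    have "\<not> open {x}"
    proof
      assume "open {x}"
      then obtain X where X: "x \<in> Pi\<^sub>E UNIV X" "finite {i. X i \<noteq> UNIV}" "Pi\<^sub>E UNIV X \<subseteq> {x}"
        using product_topology_open_contains_basis[of "\<lambda>_::nat. euclidean :: bool topology" UNIV "{x}" x]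
        by (simp add: open_fun_def) blast
      obtain k where k: "X k = UNIV"
        using ex_new_if_finite[OF infinite_UNIV_nat X(2)] by auto
      have "x(k := \<not> x k) \<in> Pi\<^sub>E UNIV X"
        using X(1) k by (simp add: PiE_iff)
      with X(3) have "x(k := \<not> x k) = x" by blast
      from fun_cong[OF this, of k] show False by simp
    qed
    then have "interior {x} \<noteq> {x}"
      using open_interior[of "{x}"] by metis
    then have "interior {x} = {}"
      using interior_subset[of "{x}"] by (simp add: subset_singleton_iff)
    moreover have "closed {y. \<forall>n. y n = x n}"
      by (intro closed_Collect_all closed_Collect_eq continuous_on_product_coordinates
          continuous_on_const)
    then have "closed {x}"
      by (simp flip: fun_eq_iff)
    ultimately show ?thesis
      unfolding nowhere_dense_def by (simp add: closure_closed)
  qed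
  then have "meager {x :: nat \<Rightarrow> bool}" for x
    unfolding meager_def by (intro exI[of _ "\<lambda>_. {x}"]) simp
  then have "meager_cover (range (\<lambda>x. {x}))"
    unfolding meager_cover_def by auto
  then show ?thesis ..
qed

definition dense_family :: "nat set set \<Rightarrow> nat set set \<Rightarrow> bool" where
  "dense_family \<B> \<A> \<longleftrightarrow> \<A> \<subseteq> {A \<in> \<B>. infinite A} \<and> (\<forall>B\<in>\<B>. infinite B \<longrightarrow> (\<exists>A\<in>\<A>. A \<subseteq> B))"

definition algebra_density :: "nat set set \<Rightarrow> nat set rel" where
  "algebra_density \<B> = least_card {\<A>. dense_family \<B> \<A>}"

lemma dense_family_all: "dense_family \<B> {A \<in> \<B>. infinite A}"
  unfolding dense_family_def by auto

text \<open>
  A measure on \<open>\<B>\<close> is a total function of which only the values on \<open>\<B>\<close> matter. Its total mass may be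
  any number in \<open>[0,1]\<close>.
\<close>

definition fa_measure_on :: "nat set set \<Rightarrow> (nat set \<Rightarrow> real) \<Rightarrow> bool" where
  "fa_measure_on \<B> \<mu> \<longleftrightarrow>
     \<mu> \<in> \<B> \<rightarrow> {0..1} \<and> additive \<B> \<mu> \<and> (\<forall>F\<in>\<B>. finite F \<longrightarrow> \<mu> F = 0)"

definition atomless :: "(nat set \<Rightarrow> real) \<Rightarrow> bool" where
  "atomless \<nu> \<longleftrightarrow> (\<forall>A. \<nu> A > 0 \<longrightarrow> (\<exists>B\<subseteq>A. 0 < \<nu> B \<and> \<nu> B < \<nu> A))"

definition strong_Q_measure :: "(nat set \<Rightarrow> real) \<Rightarrow> bool" where
  "strong_Q_measure \<nu> \<longleftrightarrow> fa_measure_on UNIV \<nu> \<and>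
     (\<forall>P :: nat \<Rightarrow> nat set. partition_on UNIV (range P) \<and> (\<forall>n. finite (P n)) \<longrightarrow>
        (\<exists>A. \<nu> A \<ge> \<nu> UNIV \<and> (\<forall>n. card (A \<inter> P n) \<le> 1)))"

end

theory Submission
  imports Defs
begin

text \<open>
  If \<open>d = cov(\<M>)\<close>, fix a small dense family of the algebra and a generic colouring of \<open>\<omega>\<close> all of whose
  colour classes meet every member of it. Recursively along a dominating family \<open>D\<close>, choose for each
  \<open>g \<in> D\<close> a generic set \<open>R g\<close> with \<open>g a < b\<close> for all \<open>a < b\<close> in it; each choice only has to meet fewer
  than \<open>cov(\<M>)\<close> dense sets, so finite intersections of the \<open>R g\<close> and a colour class still meet every
  infinite member of the algebra. By compactness of \<open>[0,1]\<close> to the power \<open>P(\<omega>)\<close> the measure extends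
  so that every \<open>R g\<close> has full measure and the colours modulo \<open>2 ^ n\<close> have measure at most
  \<open>1 / 2 ^ n\<close>: finitely many constraints are met by a finite sum of point masses. Every finite
  partition is dominated by some \<open>g \<in> D\<close>, so that \<open>R g\<close> minus a finite set is a selector.

  If \<open>cov(\<M>) < d\<close>, take a small cover by meager sets. Each \<open>M\<close> in it comes with blocks
  \<open>[m, \<phi> m)\<close> and patterns \<open>y m\<close> such that every \<open>x \<in> M\<close> misses almost all of the patterns. As the
  cover is smaller than \<open>d\<close>, there is one sequence \<open>J\<close> whose intervals \<open>[J n, J (n + 1))\<close> contain
  blocks of any finitely many members of the cover, for infinitely many \<open>n\<close>. The sets \<open>B M\<close> of binary
  strings of length \<open>J (n + 1)\<close> following a pattern of \<open>M\<close> on a block within \<open>[J n, J (n + 1))\<close>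
  generate a filter. A set with at most one string of each length codes a point \<open>x \<in> M\<close> of the
  Cantor space for some \<open>M\<close>, so it has finite intersection with \<open>B M\<close>. Hence no strong \<open>Q\<close>-measure
  is \<open>1\<close> on this filter.
\<close>

subsection \<open>Meager sets in the Cantor space\<close>

definition cyl :: "(nat \<Rightarrow> bool) \<Rightarrow> nat \<Rightarrow> (nat \<Rightarrow> bool) set" where
  "cyl x n = {y. \<forall>k<n. y k = x k}"

lemma self_in_cyl [simp]: "x \<in> cyl x n"
  by (simp add: cyl_def)

lemma open_cyl: "open (cyl x n)"
proof -
  have "cyl x n = (\<Inter>k\<in>{..<n}. (\<lambda>y. y k) -` {x k})"
    by (auto simp: cyl_def)
  moreover have "open ((\<lambda>y. y k) -` {x k})" for k
    by (intro open_vimage open_discrete continuous_on_product_coordinates)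
  ultimately show ?thesis
    by (simp add: open_INT)
qed

lemma cyl_basis:
  assumes "open S" "x \<in> S"
  shows "\<exists>n. cyl x n \<subseteq> S"
proof -
  obtain X where X: "x \<in> Pi\<^sub>E UNIV X" "finite {i. X i \<noteq> UNIV}" "Pi\<^sub>E UNIV X \<subseteq> S"
    using product_topology_open_contains_basis[of "\<lambda>_::nat. euclidean :: bool topology" UNIV S x] assms
    by (simp add: open_fun_def) blast
  obtain n where n: "\<And>i. X i \<noteq> UNIV \<Longrightarrow> i < n"
    using X(2) finite_nat_set_iff_bounded by auto
  have "cyl x n \<subseteq> Pi\<^sub>E UNIV X"
  proof
    fix y assume "y \<in> cyl x n"
    then have "y i \<in> X i" for i
      using n[of i] X(1) by (cases "X i = UNIV") (auto simp: cyl_def PiE_iff)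
    then show "y \<in> Pi\<^sub>E UNIV X" by auto
  qed
  with X(3) show ?thesis by blast
qed

text \<open>Reduces nowhere density to finite extensions: an open cylinder that misses
  \<open>N\<close> also misses \<open>closure N\<close>, and cylinders form a base.\<close>

lemma nowhere_dense_iff_cyl:
  "nowhere_dense N \<longleftrightarrow> (\<forall>x n. \<exists>y\<in>cyl x n. \<exists>l. cyl y l \<inter> N = {})"
proof
  assume N: "nowhere_dense N"
  show "\<forall>x n. \<exists>y\<in>cyl x n. \<exists>l. cyl y l \<inter> N = {}"
  proof (intro allI)
    fix x n
    have "\<not> cyl x n \<subseteq> closure N"
      using N interior_maximal[OF _ open_cyl, of x n "closure N"] self_in_cyl
      unfolding nowhere_dense_def by blast
    then obtain y where y: "y \<in> cyl x n" "y \<in> - closure N" by blast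
    obtain l where "cyl y l \<subseteq> - closure N"
      using cyl_basis[OF _ y(2)] by blast
    then have "cyl y l \<inter> N = {}"
      using closure_subset[of N] by blast
    with y(1) show "\<exists>y\<in>cyl x n. \<exists>l. cyl y l \<inter> N = {}" by blast
  qed
next
  assume *: "\<forall>x n. \<exists>y\<in>cyl x n. \<exists>l. cyl y l \<inter> N = {}"
  have "x \<notin> interior (closure N)" for x
  proof
    assume "x \<in> interior (closure N)"
    then obtain n where n: "cyl x n \<subseteq> interior (closure N)"
      using cyl_basis by blast
    obtain y l where y: "y \<in> cyl x n" "cyl y l \<inter> N = {}"
      using * by blast
    then have "cyl y l \<inter> closure N = {}"
      using open_Int_closure_eq_empty[OF open_cyl] by blast
    then have "y \<notin> closure N"
      using self_in_cyl by blast
    with y(1) n show False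
      using interior_subset by blast
  qed
  then show "nowhere_dense N"
    unfolding nowhere_dense_def by blast
qed

text \<open>Plays the part of Martin's axiom for Cohen forcing. Each \<open>U i m\<close> contains a
  dense open set, and the countably many exceptions for one \<open>i\<close> fit into a single
  meager set \<open>M i\<close>. Without a common point these sets would be a cover of size at most
  \<open>|I|\<close>.\<close>

lemma cov_meager_generic:
  fixes U :: "'i \<Rightarrow> nat \<Rightarrow> (nat \<Rightarrow> bool) set"
  assumes I: "|I| <o cov_meager"
    and U: "\<And>i m x n. i \<in> I \<Longrightarrow> \<exists>y\<in>cyl x n. \<exists>l. cyl y l \<subseteq> U i m"
  shows "\<exists>x. \<forall>i\<in>I. \<forall>m. x \<in> U i m"
proof (rule ccontr)
  assume no: "\<nexists>x. \<forall>i\<in>I. \<forall>m. x \<in> U i m"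
  define M where "M i = (\<Union>m. - U i m)" for i
  have "nowhere_dense (- U i m)" if "i \<in> I" for i m
    unfolding nowhere_dense_iff_cyl using U[OF that] by (metis disjoint_eq_subset_Compl double_complement)
  then have "meager (M i)" if "i \<in> I" for i
    unfolding meager_def M_def using that by (intro exI[of _ "\<lambda>m. - U i m"]) simp
  moreover have "\<Union>(M ` I) = UNIV"
    using no by (auto simp: M_def)
  ultimately have "meager_cover (M ` I)"
    unfolding meager_cover_def by blast
  then have "cov_meager \<le>o |M ` I|"
    unfolding cov_meager_def using least_card(2)[of "{\<F>. meager_cover \<F>}"] by blast
  also have "|M ` I| \<le>o |I|" by (rule card_of_image)
  finally show False
    using I not_ordLess_ordLeq by blast
qed

subsection \<open>Cardinals below the dominating number\<close>

lemma dominating_number_witness: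
  obtains D where "dominating D" "dominating_number = |D|"
  using least_card(1)[of "{D. dominating D}"] dominating_UNIV
  unfolding dominating_number_def by blast

lemma dominating_number_le: "dominating D \<Longrightarrow> dominating_number \<le>o |D|"
  unfolding dominating_number_def using least_card(2)[of "{D. dominating D}" D] by blast

lemma cov_meager_witness:
  obtains \<F> where "meager_cover \<F>" "cov_meager = |\<F>|"
  using least_card(1)[of "{D. meager_cover D}"] ex_meager_cover
  unfolding cov_meager_def by blast

lemma cov_meager_le: "meager_cover \<F> \<Longrightarrow> cov_meager \<le>o |\<F>|"
  unfolding cov_meager_def using least_card(2)[of "{D. meager_cover D}" \<F>] by blast

lemma not_dominating_if_small:
  fixes G :: "(nat \<Rightarrow> nat) set"
  assumes "|G| <o dominating_number"
  shows "\<exists>f. \<forall>g\<in>G. \<not> (\<forall>\<^sub>F n in sequentially. f n < g n)"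
proof -
  have "\<not> dominating G"
    using assms dominating_number_le not_ordLess_ordLeq by blast
  then show ?thesis unfolding dominating_def by blast
qed

text \<open>If \<open>g\<close> dominates the function sending \<open>n\<close> to the next one of
  \<open>x\<close> from \<open>n\<close> on, then \<open>x\<close> has a one in
  \<open>[n, g n)\<close> for almost all \<open>n\<close>. For a fixed \<open>g\<close> such points
  form a meager set.\<close>

lemma cov_meager_le_dominating_number: "cov_meager \<le>o dominating_number"
proof -
  obtain D where D: "dominating D" "dominating_number = |D|"
    by (rule dominating_number_witness)
  \<comment> \<open>The second alternative takes care of the points with only finitely many
    ones.\<close>
  define N where "N g m = {x. (\<forall>n\<ge>m. \<exists>k\<ge>n. k < g n \<and> x k) \<or> (\<forall>k\<ge>m. \<not> x k)}"
    for g :: "nat \<Rightarrow> nat" and m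
  have "nowhere_dense (N g m)" for g m
    unfolding nowhere_dense_iff_cyl
  proof (intro allI)
    fix x n
    \<comment> \<open>After the given first \<open>n\<close> bits, \<open>y\<close> has zeros up to
      \<open>q\<close>, hence on \<open>[p, g p)\<close>, which refutes the first alternative. The
      one at \<open>q \<ge> m\<close> refutes the second.\<close>
    define p where "p = max n m"
    define q where "q = max p (g p)"
    define y where "y k \<longleftrightarrow> (if k < n then x k else k = q)" for k
    have "y \<in> cyl x n"
      by (simp add: cyl_def y_def)
    moreover have "z \<notin> N g m" if "z \<in> cyl y (Suc q)" for z
    proof -
      have z: "z k = y k" if "k \<le> q" for k
        using \<open>z \<in> _\<close> that by (auto simp: cyl_def)
      have pq: "n \<le> p" "m \<le> p" "p \<le> q" "g p \<le> q"
        by (auto simp: p_def q_def)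
      have "z q"
        using z[of q] pq by (simp add: y_def)
      moreover have "\<not> z k" if "k \<ge> p" "k < g p" for k
        using z[of k] that pq by (simp add: y_def)
      ultimately show ?thesis
        using pq unfolding N_def by (auto intro: order_trans)
    qed
    ultimately show "\<exists>y\<in>cyl x n. \<exists>l. cyl y l \<inter> N g m = {}"
      by blast
  qed
  then have "meager (\<Union>m. N g m)" for g
    unfolding meager_def by blast
  moreover have "\<exists>g\<in>D. x \<in> (\<Union>m. N g m)" for x
  proof (cases "\<exists>m. \<forall>k\<ge>m. \<not> x k")
    case True
    moreover obtain g where "g \<in> D"
      using D(1) unfolding dominating_def by blast
    ultimately show ?thesis
      by (auto simp: N_def)
  next
    case False
    define f where "f n = (LEAST k. k \<ge> n \<and> x k)" for n
    have f: "f n \<ge> n \<and> x (f n)" for n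
      unfolding f_def by (rule LeastI_ex) (use False in blast)
    obtain g where g: "g \<in> D" "\<forall>\<^sub>F n in sequentially. f n < g n"
      using D(1) unfolding dominating_def by blast
    then obtain m where "\<forall>n\<ge>m. f n < g n"
      by (auto simp: eventually_sequentially)
    then have "x \<in> N g m"
      unfolding N_def using f by blast
    with g(1) show ?thesis by blast
  qed
  ultimately have "meager_cover ((\<lambda>g. \<Union>m. N g m) ` D)"
    unfolding meager_cover_def by blast
  then have "cov_meager \<le>o |(\<lambda>g. \<Union>m. N g m) ` D|"
    by (rule cov_meager_le)
  also have "|(\<lambda>g. \<Union>m. N g m) ` D| \<le>o |D|" by (rule card_of_image)
  finally show ?thesis by (simp add: D(2))
qed

lemma finite_ordLess_nat: "finite A \<Longrightarrow> |A| <o |UNIV :: nat set|"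
  by (rule finite_ordLess_infinite[OF card_of_Well_order card_of_Well_order]) (simp_all add: Field_card_of)

lemma nat_less_dominating_number: "|UNIV :: nat set| <o dominating_number"
proof -
  obtain D where D: "dominating D" "dominating_number = |D|"
    by (rule dominating_number_witness)
  have "\<not> |D| \<le>o |UNIV :: nat set|"
  proof
    assume "|D| \<le>o |UNIV :: nat set|"
    then have "countable D"
      by (auto simp: countable_def card_of_ordLeq[symmetric])
    have "D \<noteq> {}" using D(1) unfolding dominating_def by blast
    \<comment> \<open>Diagonal function: it is at least the \<open>i\<close>-th member of
      \<open>D\<close> at every \<open>n \<ge> i\<close>, so no member is eventually above
      it.\<close>
    define f where "f n = (\<Sum>i\<le>n. from_nat_into D i n)" for n
    obtain g where g: "g \<in> D" "\<forall>\<^sub>F n in sequentially. f n < g n"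
      using D(1) unfolding dominating_def by blast
    obtain i where i: "g = from_nat_into D i"
      using from_nat_into_surj[OF \<open>countable D\<close> g(1)] by metis
    have "\<forall>\<^sub>F n in sequentially. i \<le> n"
      by (rule eventually_ge_at_top)
    then have "\<forall>\<^sub>F n in sequentially. f n < g n \<and> i \<le> n"
      using g(2) eventually_conj by blast
    then obtain n where n: "f n < g n" "i \<le> n"
      by (metis (mono_tags, lifting) eventually_sequentially order_refl)
    have "g n \<le> f n"
      unfolding f_def i using n(2) by (intro member_le_sum) auto
    with n show False by simp
  qed
  then show ?thesis
    unfolding D(2) using ordLess_or_ordLeq[OF card_of_Well_order card_of_Well_order] by blast
qed

lemma infinite_dominating_number:
  assumes "dominating_number = |D|"
  shows "infinite D"
proof
  assume "finite D"
  then have "|D| <o |UNIV :: nat set|"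
    by (rule finite_ordLess_nat)
  with nat_less_dominating_number assms show False
    using ordLess_transitive ordLess_irreflexive by metis
qed

lemma Times_nat_less_dominating_number:
  assumes "|A| <o dominating_number"
  shows "|A \<times> (UNIV :: nat set)| <o dominating_number"
proof (cases "finite A")
  case True
  then have "|A| \<le>o |UNIV :: nat set|"
    by (intro ordLess_imp_ordLeq finite_ordLess_nat)
  then have "|A \<times> (UNIV :: nat set)| \<le>o |UNIV :: nat set|"
    by (intro card_of_Sigma_ordLeq_infinite) (auto intro: card_of_mono1)
  then show ?thesis
    using nat_less_dominating_number ordLeq_ordLess_trans by blast
next
  case False
  then have "|A \<times> (UNIV :: nat set)| \<le>o |A|"
    using infinite_iff_card_of_nat[of A] by (intro card_of_Sigma_ordLeq_infinite) (auto intro: card_of_mono1)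
  then show ?thesis
    using assms ordLeq_ordLess_trans by blast
qed

lemma Un_less_dominating_number:
  assumes "|A| <o dominating_number" "|B| <o dominating_number"
  shows "|A \<union> B| <o dominating_number"
proof -
  obtain D :: "(nat \<Rightarrow> nat) set" where D: "dominating_number = |D|"
    by (rule dominating_number_witness)
  show ?thesis
    using assms infinite_dominating_number[OF D] unfolding D
    by (intro card_of_Un_ordLess_infinite)
qed

section \<open>Closures under a binary operation\<close>

text \<open>The operation is a parameter since three closures are used: under composition of
  functions, under intersection, and under complemented intersection, which yields Boolean
  algebras.\<close>

inductive_set binary_closure :: "('a \<Rightarrow> 'a \<Rightarrow> 'a) \<Rightarrow> 'a set \<Rightarrow> 'a set" for op S where
  base: "x \<in> S \<Longrightarrow> x \<in> binary_closure op S"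
| step: "x \<in> binary_closure op S \<Longrightarrow> y \<in> binary_closure op S \<Longrightarrow> op x y \<in> binary_closure op S"

text \<open>The closure is exhausted by countably many stages \<open>it n\<close>. Each stage stays
  within \<open>|B|\<close> because an infinite \<open>B\<close> absorbs its square.\<close>

lemma card_of_binary_closure:
  fixes S :: "'a set"
  assumes S: "|S| \<le>o |B|" and B: "infinite B"
  shows "|binary_closure op S| \<le>o |B|"
proof -
  define it where "it n = ((\<lambda>T. T \<union> (\<lambda>(x, y). op x y) ` (T \<times> T)) ^^ n) S" for n
  have it_0: "it 0 = S" and it_Suc: "it (Suc n) = it n \<union> (\<lambda>(x, y). op x y) ` (it n \<times> it n)" for n
    by (simp_all add: it_def)
  have mono: "it m \<subseteq> it n" if "m \<le> n" for m n
    by (rule lift_Suc_mono_le[OF _ that]) (simp add: it_Suc)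
  have "|it n| \<le>o |B|" for n
  proof (induction n)
    case 0
    then show ?case using S by (simp add: it_0)
  next
    case (Suc n)
    have "|it n \<times> it n| \<le>o |B|"
      using Suc B by (simp add: card_of_Sigma_ordLeq_infinite)
    then have "|(\<lambda>(x, y). op x y) ` (it n \<times> it n)| \<le>o |B|"
      using card_of_image ordLeq_transitive by blast
    with Suc B show ?case
      unfolding it_Suc by (intro card_of_Un_ordLeq_infinite_Field card_of_Card_order) (simp_all add: Field_card_of)
  qed
  moreover have "|UNIV :: nat set| \<le>o |B|"
    using B infinite_iff_card_of_nat by blast
  ultimately have "|\<Union>n. it n| \<le>o |B|"
    by (intro card_of_UNION_ordLeq_infinite B) auto
  moreover have "binary_closure op S \<subseteq> (\<Union>n. it n)"
  proof
    fix x assume "x \<in> binary_closure op S"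
    then show "x \<in> (\<Union>n. it n)"
    proof induction
      case (base x)
      then show ?case using it_0 by blast
    next
      case (step x y)
      then obtain m n where "x \<in> it m" "y \<in> it n" by blast
      then have "x \<in> it (max m n)" "y \<in> it (max m n)"
        using mono[of m "max m n"] mono[of n "max m n"] by auto
      then have "op x y \<in> it (Suc (max m n))"
        unfolding it_Suc by (intro UnI2 image_eqI[of _ _ "(x, y)"]) auto
      then show ?case by blast
    qed
  qed
  then have "|binary_closure op S| \<le>o |\<Union>n. it n|"
    by (rule card_of_mono1)
  ultimately show ?thesis
    using ordLeq_transitive by blast
qed

text \<open>A finite \<open>S\<close> may have an infinite closure, but only a countable one, and
  \<open>dominating_number\<close> is uncountable.\<close>

lemma binary_closure_less_dominating_number:
  fixes S :: "'a set"
  assumes S: "|S| <o dominating_number"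
  shows "|binary_closure op S| <o dominating_number"
proof (cases "finite S")
  case True
  then have "|S| \<le>o |UNIV :: nat set|"
    by (intro ordLess_imp_ordLeq finite_ordLess_nat)
  then show ?thesis
    using card_of_binary_closure nat_less_dominating_number ordLeq_ordLess_trans infinite_UNIV_nat by blast
next
  case False
  then show ?thesis
    using card_of_binary_closure[OF ordLeq_refl[OF card_of_Card_order]] S ordLeq_ordLess_trans by blast
qed

lemma image_less_dominating_number:
  "|S| <o dominating_number \<Longrightarrow> |f ` S| <o dominating_number"
  using card_of_image ordLeq_ordLess_trans by blast

subsection \<open>A filter base from a small cover by meager sets\<close>

definition agree :: "nat set \<Rightarrow> (nat \<Rightarrow> bool) \<Rightarrow> (nat \<Rightarrow> bool) \<Rightarrow> bool" where
  "agree I x y \<longleftrightarrow> (\<forall>k\<in>I. x k = y k)"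

text \<open>The pairs in \<open>T\<close>, a nowhere dense set with an initial segment below
  \<open>m\<close>, are served one at a time. The segment of the new pair followed by the string
  \<open>\<sigma>\<close> found so far is extended until it leaves the new set; lengthening
  \<open>\<sigma>\<close> keeps the earlier pairs served.\<close>

lemma nowhere_dense_avoid_finite:
  fixes T :: "((nat \<Rightarrow> bool) set \<times> (nat \<Rightarrow> bool)) set"
  assumes "finite T" "\<And>t. t \<in> T \<Longrightarrow> nowhere_dense (fst t)"
  shows "\<exists>l \<sigma>. m \<le> l \<and>
    (\<forall>t\<in>T. \<forall>x. agree {..<m} x (snd t) \<longrightarrow> agree {m..<l} x \<sigma> \<longrightarrow> x \<notin> fst t)"
  using assms
proof (induction T rule: finite_induct)
  case empty
  show ?case by (intro exI[of _ m]) simp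
next
  case (insert t T)
  have "\<And>t. t \<in> T \<Longrightarrow> nowhere_dense (fst t)" using insert.prems by blast
  then obtain l \<sigma> where l: "m \<le> l" and
    \<sigma>: "\<And>t x. t \<in> T \<Longrightarrow> agree {..<m} x (snd t) \<Longrightarrow> agree {m..<l} x \<sigma> \<Longrightarrow> x \<notin> fst t"
    using insert.IH by blast
  define x0 where "x0 k = (if k < m then snd t k else \<sigma> k)" for k
  have "nowhere_dense (fst t)"
    using insert.prems by blast
  then obtain y l' where y: "y \<in> cyl x0 l" and l': "cyl y l' \<inter> fst t = {}"
    unfolding nowhere_dense_iff_cyl by blast
  have "x \<notin> fst s"
    if s: "s \<in> insert t T" and x: "agree {..<m} x (snd s)" "agree {m..<max l l'} x y" for s x
  proof (cases "s = t")
    case True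
    have "x k = y k" if "k < l'" for k
    proof (cases "k < m")
      case True
      then show ?thesis
        using x(1) y l \<open>s = t\<close> by (simp add: agree_def cyl_def x0_def)
    next
      case False
      then show ?thesis
        using x(2) that by (simp add: agree_def)
    qed
    then have "x \<in> cyl y l'" by (simp add: cyl_def)
    then show ?thesis using l' True by blast
  next
    case False
    then have "s \<in> T" using s by blast
    moreover have "agree {m..<l} x \<sigma>"
      using x(2) y by (auto simp: agree_def cyl_def x0_def)
    ultimately show ?thesis using \<sigma> x(1) by blast
  qed
  moreover have "m \<le> max l l'" using l by simp
  ultimately show ?case by blast
qed

text \<open>The combinatorial description of meager sets by blocks and patterns. The block at
  \<open>m\<close> deals at once with the sets \<open>N 0, ..., N m\<close> and all initial segments
  of length \<open>m\<close>, so a point of \<open>N m0\<close> misses every pattern from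
  \<open>m0\<close> on.\<close>

lemma meager_avoid:
  fixes M :: "(nat \<Rightarrow> bool) set"
  assumes "meager M"
  shows "\<exists>\<phi> y. (\<forall>m. m \<le> \<phi> m) \<and> (\<forall>x\<in>M. \<exists>m0. \<forall>m\<ge>m0. \<not> agree {m..<\<phi> m} x (y m))"
proof -
  obtain N :: "nat \<Rightarrow> (nat \<Rightarrow> bool) set" where N: "\<And>i. nowhere_dense (N i)" "M = (\<Union>i. N i)"
    using assms unfolding meager_def by blast
  define T where "T m = N ` {..m} \<times> (\<lambda>S k. k \<in> S) ` Pow {..<m}" for m :: nat
  have "\<forall>m. \<exists>l \<sigma>. m \<le> l \<and>
    (\<forall>t\<in>T m. \<forall>x. agree {..<m} x (snd t) \<longrightarrow> agree {m..<l} x \<sigma> \<longrightarrow> x \<notin> fst t)"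
  proof
    fix m
    show "\<exists>l \<sigma>. m \<le> l \<and>
      (\<forall>t\<in>T m. \<forall>x. agree {..<m} x (snd t) \<longrightarrow> agree {m..<l} x \<sigma> \<longrightarrow> x \<notin> fst t)"
      by (rule nowhere_dense_avoid_finite) (use N(1) in \<open>auto simp: T_def\<close>)
  qed
  then obtain \<phi> y where \<phi>: "\<And>m. m \<le> \<phi> m" and
    y: "\<And>m. \<forall>t\<in>T m. \<forall>x. agree {..<m} x (snd t) \<longrightarrow> agree {m..<\<phi> m} x (y m) \<longrightarrow> x \<notin> fst t"
    unfolding choice_iff by blast
  have "\<not> agree {m..<\<phi> m} x (y m)" if x: "x \<in> N m0" and m: "m0 \<le> m" for x m0 m
  proof -
    have "(N m0, \<lambda>k. k \<in> {k. k < m \<and> x k}) \<in> T m"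
      unfolding T_def using m by (intro SigmaI imageI) auto
    moreover have "agree {..<m} x (\<lambda>k. k \<in> {k. k < m \<and> x k})"
      by (simp add: agree_def)
    ultimately show ?thesis using y[of m] x by fastforce
  qed
  then show ?thesis
    using \<phi> N(2) by (intro exI[of _ \<phi>] exI[of _ y]) blast
qed

text \<open>
  If an increasing \<open>h\<close> is not dominated by \<open>\<psi> \<circ> \<psi>\<close> for any \<open>\<psi>\<close> in the (monotonised) family, the
  orbit of \<open>0\<close> under \<open>h\<close> works: \<open>h (J n) < \<psi> (J n)\<close> for almost all \<open>n\<close> would give
  \<open>h m < \<psi> (\<psi> m)\<close> for almost all \<open>m\<close>.
\<close>

lemma infinitely_often_absorbing_sequence:
  fixes G :: "(nat \<Rightarrow> nat) set"
  assumes "|G| <o dominating_number"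
  shows "\<exists>J :: nat \<Rightarrow> nat. strict_mono J \<and> (\<forall>\<psi>\<in>G. \<exists>\<^sub>\<infinity>n. \<psi> (J n) \<le> J (Suc n))"
proof -
  define \<Psi> :: "(nat \<Rightarrow> nat) \<Rightarrow> nat \<Rightarrow> nat" where "\<Psi> \<psi> m = (\<Sum>j\<le>m. \<psi> j)" for \<psi> m
  have mono_\<Psi>: "\<Psi> \<psi> a \<le> \<Psi> \<psi> b" if "a \<le> b" for \<psi> a b
    unfolding \<Psi>_def using that by (intro sum_mono2) auto
  have ge_\<Psi>: "\<psi> a \<le> \<Psi> \<psi> a" for \<psi> a
    unfolding \<Psi>_def by (rule member_le_sum) auto
  have "|(\<lambda>\<psi>. \<Psi> \<psi> \<circ> \<Psi> \<psi>) ` G| <o dominating_number"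
    using assms by (rule image_less_dominating_number)
  then obtain f where f: "\<And>\<psi>. \<psi> \<in> G \<Longrightarrow> \<not> (\<forall>\<^sub>F n in sequentially. f n < \<Psi> \<psi> (\<Psi> \<psi> n))"
    using not_dominating_if_small by fastforce
  \<comment> \<open>Makes \<open>h\<close> monotone, above \<open>f\<close> and above the identity,
    so that its orbit \<open>J\<close> is strictly increasing.\<close>
  define h where "h n = \<Psi> f n + Suc n" for n
  have mono_h: "h a \<le> h b" if "a \<le> b" for a b
    using mono_\<Psi>[OF that, of f] that by (simp add: h_def)
  have f_le: "f a \<le> h a" for a
    using ge_\<Psi>[of f a] by (simp add: h_def)
  define J where "J n = (h ^^ n) 0" for n
  have J_Suc: "J (Suc n) = h (J n)" for n
    by (simp add: J_def)
  have J: "strict_mono J"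
    by (rule strict_mono_Suc_iff[THEN iffD2]) (simp add: J_Suc h_def)
  have "\<exists>\<^sub>\<infinity>n. \<psi> (J n) \<le> J (Suc n)" if "\<psi> \<in> G" for \<psi>
  proof (rule ccontr)
    assume "\<not> (\<exists>\<^sub>\<infinity>n. \<psi> (J n) \<le> J (Suc n))"
    then obtain n0 where n0: "\<And>n. n \<ge> n0 \<Longrightarrow> h (J n) < \<psi> (J n)"
      unfolding INFM_nat_le J_Suc not_all not_ex by (metis not_le)
    have "f m < \<Psi> \<psi> (\<Psi> \<psi> m)" if m: "m \<ge> J n0" for m
    proof -
      \<comment> \<open>The index with \<open>J n \<le> m < J (Suc n)\<close>; the search is bounded
        because \<open>k \<le> J k\<close>.\<close>
      define n where "n = (GREATEST n. J n \<le> m)"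
      have bound: "k \<le> m" if "J k \<le> m" for k
        using strict_mono_imp_increasing[OF J, of k] that by simp
      have "J n \<le> m"
        unfolding n_def using GreatestI_nat[where P = "\<lambda>n. J n \<le> m", OF m bound] by simp
      have greatest: "k \<le> n" if "J k \<le> m" for k
        using Greatest_le_nat[where P = "\<lambda>n. J n \<le> m", OF that bound] by (simp add: n_def)
      have "n0 \<le> n" using m by (rule greatest)
      have "m < J (Suc n)"
        using greatest[of "Suc n"] by (metis not_le not_less_eq_eq order_refl)
      have "J (Suc n) \<le> \<Psi> \<psi> (J n)"
        using n0[of n] ge_\<Psi>[of \<psi> "J n"] \<open>n0 \<le> n\<close> by (simp add: J_Suc)
      moreover have "\<Psi> \<psi> (J n) \<le> \<Psi> \<psi> m"
        using \<open>J n \<le> m\<close> by (rule mono_\<Psi>)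
      ultimately have le: "J (Suc n) \<le> \<Psi> \<psi> m"
        by simp
      \<comment> \<open>The assumption is used twice: at \<open>n\<close> it put
        \<open>J (Suc n) = h (J n)\<close> below \<open>\<Psi> \<psi> m\<close>, and at
        \<open>Suc n\<close> it bounds \<open>h (J (Suc n))\<close>. This is why
        \<open>\<Psi> \<psi>\<close> occurs squared.\<close>
      have "f m \<le> h (J (Suc n))"
        using f_le[of m] mono_h[of m "J (Suc n)"] \<open>m < J (Suc n)\<close> by simp
      also have "\<dots> < \<psi> (J (Suc n))"
        using n0[of "Suc n"] \<open>n0 \<le> n\<close> by simp
      also have "\<dots> \<le> \<Psi> \<psi> (J (Suc n))" by (rule ge_\<Psi>)
      also have "\<dots> \<le> \<Psi> \<psi> (\<Psi> \<psi> m)" using le by (rule mono_\<Psi>)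
      finally show ?thesis .
    qed
    then show False
      using f[OF \<open>\<psi> \<in> G\<close>] by (auto simp: eventually_sequentially)
  qed
  with J show ?thesis by blast
qed

text \<open>Strings of length \<open>n\<close> form the block \<open>P n\<close>, moved to the
  natural numbers by a bijection. The images of the sets \<open>B M\<close> have infinite finite
  intersections because patterns can be concatenated, whereas a selector codes a point of the Cantor
  space, which some \<open>M\<close> of the cover must contain.\<close>

lemma small_cov_meager_filter_base:
  assumes small: "cov_meager <o dominating_number"
  obtains \<G> :: "nat set set" and P :: "nat \<Rightarrow> nat set" where
    "|\<G>| <o dominating_number"
    "\<And>H. H \<subseteq> \<G> \<Longrightarrow> finite H \<Longrightarrow> infinite (\<Inter>H)"
    "partition_on UNIV (range P)" "\<And>n. finite (P n)"
    "\<And>A. (\<And>n. card (A \<inter> P n) \<le> 1) \<Longrightarrow> \<exists>B\<in>\<G>. finite (A \<inter> B)"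
proof -
  obtain \<F> where \<F>: "meager_cover \<F>" "cov_meager = |\<F>|"
    by (rule cov_meager_witness)
  have "\<forall>M\<in>\<F>. \<exists>\<phi> y. (\<forall>m. m \<le> \<phi> m) \<and>
    (\<forall>x\<in>M. \<exists>m0. \<forall>m\<ge>m0. \<not> agree {m..<\<phi> m} x (y m))"
    using \<F>(1) meager_avoid unfolding meager_cover_def by blast
  then obtain \<phi> y where \<phi>: "\<And>M m. M \<in> \<F> \<Longrightarrow> m \<le> \<phi> M m" and
    y: "\<And>M x. M \<in> \<F> \<Longrightarrow> x \<in> M \<Longrightarrow> \<exists>m0. \<forall>m\<ge>m0. \<not> agree {m..<\<phi> M m} x (y M m)"
    by metis
  \<comment> \<open>A composition of several \<open>\<phi> M\<close> gives room for blocks of all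
    these \<open>M\<close> one after another. Closing under composition keeps the family below
    \<open>dominating_number\<close>.\<close>
  define C where "C = binary_closure (\<circ>) (\<phi> ` \<F>)"
  have "|C| <o dominating_number"
    unfolding C_def using small[unfolded \<F>(2)]
    by (intro binary_closure_less_dominating_number image_less_dominating_number)
  then obtain J where J: "strict_mono J" "\<And>\<psi>. \<psi> \<in> C \<Longrightarrow> \<exists>\<^sub>\<infinity>n. \<psi> (J n) \<le> J (Suc n)"
    using infinitely_often_absorbing_sequence by blast
  define catch where "catch M a b x \<longleftrightarrow> (\<exists>m\<ge>a. \<phi> M m \<le> b \<and> agree {m..<\<phi> M m} x (y M m))"
    for M a b x
  define B where "B M = {s :: bool list. \<exists>n. length s = J (Suc n) \<and>
    catch M (J n) (J (Suc n)) ((!) s)}" for M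

  have concat: "\<exists>\<psi>\<in>C. \<forall>m. m \<le> \<psi> m \<and> (\<exists>\<sigma>. \<forall>M\<in>H. catch M m (\<psi> m) \<sigma>)"
    if "finite H" "H \<noteq> {}" "H \<subseteq> \<F>" for H
    using that
  proof (induction H rule: finite_ne_induct)
    case (singleton M)
    then have "\<phi> M \<in> C" "\<And>m. m \<le> \<phi> M m"
      by (auto simp: C_def \<phi> intro: binary_closure.base)
    moreover have "catch M m (\<phi> M m) (y M m)" for m
      by (auto simp: catch_def agree_def)
    ultimately show ?case by blast
  next
    case (insert M H)
    then have M: "\<phi> M \<in> C" "\<And>m. m \<le> \<phi> M m"
      by (auto simp: C_def \<phi> intro: binary_closure.base)
    obtain \<psi> where \<psi>: "\<psi> \<in> C" "\<And>m. m \<le> \<psi> m"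
      and ex: "\<And>m. \<exists>\<sigma>. \<forall>M\<in>H. catch M m (\<psi> m) \<sigma>"
      using insert by auto
    have "\<exists>\<tau>. \<forall>M'\<in>insert M H. catch M' m (\<psi> (\<phi> M m)) \<tau>" for m
    proof -
      obtain \<sigma> where \<sigma>: "\<And>M'. M' \<in> H \<Longrightarrow> catch M' (\<phi> M m) (\<psi> (\<phi> M m)) \<sigma>"
        using ex[of "\<phi> M m"] by blast
      \<comment> \<open>The pattern of \<open>M\<close> fills the block at \<open>m\<close>; the
        string for \<open>H\<close> takes over where that block ends.\<close>
      define \<tau> where "\<tau> k = (if k < \<phi> M m then y M m k else \<sigma> k)" for k
      have "catch M m (\<psi> (\<phi> M m)) \<tau>"
        unfolding catch_def using \<psi>(2)[of "\<phi> M m"]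
        by (intro exI[of _ m]) (simp add: agree_def \<tau>_def)
      moreover have "catch M' m (\<psi> (\<phi> M m)) \<tau>" if M': "M' \<in> H" for M'
      proof -
        obtain m' where m': "m' \<ge> \<phi> M m" "\<phi> M' m' \<le> \<psi> (\<phi> M m)"
          "agree {m'..<\<phi> M' m'} \<sigma> (y M' m')"
          using \<sigma>[OF M'] unfolding catch_def by blast
        have "agree {m'..<\<phi> M' m'} \<tau> (y M' m')"
          using m'(1,3) by (simp add: agree_def \<tau>_def)
        moreover have "m \<le> m'" using M(2)[of m] m'(1) by simp
        ultimately show ?thesis using m'(2) unfolding catch_def by blast
      qed
      ultimately show ?thesis by blast
    qed
    moreover have "m \<le> \<psi> (\<phi> M m)" for m
      using M(2)[of m] \<psi>(2)[of "\<phi> M m"] by simp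
    moreover have "\<psi> \<circ> \<phi> M \<in> C"
      using M(1) \<psi>(1) unfolding C_def by (intro binary_closure.step)
    ultimately show ?case
      by (intro bexI[of _ "\<psi> \<circ> \<phi> M"]) (simp_all only: comp_apply, blast)
  qed

  have B_inf: "infinite (\<Inter>M\<in>H. B M)" if H: "finite H" "H \<subseteq> \<F>" for H
  proof (cases "H = {}")
    case True
    then show ?thesis by (simp add: infinite_UNIV_listI)
  next
    case False
    from concat[OF H(1) False H(2)] obtain \<psi> where \<psi>: "\<psi> \<in> C"
      and ex: "\<And>m. \<exists>\<sigma>. \<forall>M\<in>H. catch M m (\<psi> m) \<sigma>"
      by blast
    have "\<exists>s\<in>(\<Inter>M\<in>H. B M). N < length s" for N
    proof -
      obtain n where n: "N \<le> n" "\<psi> (J n) \<le> J (Suc n)"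
        using J(2)[OF \<psi>] unfolding INFM_nat_le by blast
      obtain \<sigma> where \<sigma>: "\<And>M. M \<in> H \<Longrightarrow> catch M (J n) (\<psi> (J n)) \<sigma>"
        using ex[of "J n"] by blast
      define s where "s = map \<sigma> [0..<J (Suc n)]"
      have "s \<in> B M" if M: "M \<in> H" for M
      proof -
        obtain m' where m': "m' \<ge> J n" "\<phi> M m' \<le> \<psi> (J n)"
          "agree {m'..<\<phi> M m'} \<sigma> (y M m')"
          using \<sigma>[OF M] unfolding catch_def by blast
        then have "agree {m'..<\<phi> M m'} ((!) s) (y M m')"
          using n(2) by (simp add: s_def agree_def)
        moreover have "\<phi> M m' \<le> J (Suc n)" using m'(2) n(2) by simp
        ultimately have "catch M (J n) (J (Suc n)) ((!) s)"
          unfolding catch_def using m'(1) by blast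
        moreover have "length s = J (Suc n)" by (simp add: s_def)
        ultimately show ?thesis unfolding B_def by blast
      qed
      moreover have "N < length s"
        using n(1) strict_mono_imp_increasing[OF J(1), of "Suc n"] by (simp add: s_def)
      ultimately show ?thesis by blast
    qed
    then have "\<not> finite (length ` (\<Inter>M\<in>H. B M))"
      unfolding finite_nat_set_iff_bounded_le by (metis imageI not_le)
    then show ?thesis by blast
  qed

  have B_selector: "\<exists>M\<in>\<F>. finite (A \<inter> B M)"
    if A: "\<And>s t. s \<in> A \<Longrightarrow> t \<in> A \<Longrightarrow> length s = length t \<Longrightarrow> s = t" for A
  proof -
    \<comment> \<open>The coded point: on \<open>[J n, J (Suc n))\<close> it copies the string of
      \<open>A\<close> of length \<open>J (Suc n)\<close>, with value \<open>False\<close> if there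
      is none. The \<open>LEAST\<close> equals \<open>Suc n\<close> there.\<close>
    define x where "x k \<longleftrightarrow> (\<exists>s\<in>A. length s = J (LEAST n. k < J n) \<and> s ! k)" for k
    have x_eq: "x k = s ! k" if "s \<in> A" "length s = J (Suc n)" "J n \<le> k" "k < J (Suc n)" for s n k
    proof -
      have "(LEAST n. k < J n) = Suc n"
      proof (rule Least_equality[where P = "\<lambda>n. k < J n", OF that(4)])
        fix i assume "k < J i"
        then have "J n < J i" using that(3) by simp
        then show "Suc n \<le> i"
          using strict_mono_less[OF J(1)] by auto
      qed
      then have "x k \<longleftrightarrow> (\<exists>t\<in>A. length t = J (Suc n) \<and> t ! k)"
        by (simp add: x_def)
      moreover have "t = s" if "t \<in> A" "length t = J (Suc n)" for t
        using A[OF that(1) \<open>s \<in> A\<close>] that(2) \<open>length s = J (Suc n)\<close> by simp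
      ultimately show ?thesis using \<open>s \<in> A\<close> \<open>length s = J (Suc n)\<close> by blast
    qed
    have "x \<in> \<Union>\<F>"
      using \<F>(1) by (simp add: meager_cover_def)
    then obtain M where M: "M \<in> \<F>" "x \<in> M" ..
    obtain m0 where m0: "\<And>m. m0 \<le> m \<Longrightarrow> \<not> agree {m..<\<phi> M m} x (y M m)"
      using y[OF M] by blast
    have "length s \<le> J m0" if s: "s \<in> A" "s \<in> B M" for s
    proof -
      obtain n m where nm: "length s = J (Suc n)" "J n \<le> m" "\<phi> M m \<le> J (Suc n)"
        "agree {m..<\<phi> M m} ((!) s) (y M m)"
        using s(2) unfolding B_def catch_def by blast
      have "agree {m..<\<phi> M m} x (y M m)"
        using nm x_eq[OF s(1) nm(1)] by (simp add: agree_def)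
      then have "\<not> m0 \<le> m" using m0 by blast
      \<comment> \<open>From \<open>n \<le> J n \<le> m < m0\<close>. Thus the strings in
        \<open>A\<close> and \<open>B M\<close> have bounded length, and only finitely many
        remain.\<close>
      then have "Suc n \<le> m0"
        using nm(2) strict_mono_imp_increasing[OF J(1), of n] by simp
      then show ?thesis
        using nm(1) monoD[OF strict_mono_mono[OF J(1)]] by simp
    qed
    then have "A \<inter> B M \<subseteq> {s. set s \<subseteq> UNIV \<and> length s \<le> J m0}" by auto
    then have "finite (A \<inter> B M)"
      using finite_lists_length_le[of "UNIV :: bool set"] by (rule finite_subset) simp
    with M(1) show ?thesis by blast
  qed

  obtain e :: "bool list \<Rightarrow> nat" where e: "bij e"
    using countableE_infinite[of "UNIV :: bool list set"] by (auto simp: infinite_UNIV_listI)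
  then have inj: "inj e" and surj: "surj e" by (auto simp: bij_def)
  define P where "P n = e ` {s. length s = n}" for n
  show ?thesis
  proof (rule that)
    show "|(\<lambda>M. e ` B M) ` \<F>| <o dominating_number"
      using small[unfolded \<F>(2)] by (rule image_less_dominating_number)
    show "infinite (\<Inter>H)" if H: "H \<subseteq> (\<lambda>M. e ` B M) ` \<F>" "finite H" for H
    proof -
      obtain H' where H': "H' \<subseteq> \<F>" "finite H'" "H = (\<lambda>M. e ` B M) ` H'"
        using finite_subset_image[OF H(2,1)] by blast
      have "e ` (\<Inter>M\<in>H'. B M) \<subseteq> \<Inter>H"
        using H'(3) by blast
      moreover have "infinite (e ` (\<Inter>M\<in>H'. B M))"
        using B_inf[OF H'(2,1)] inj by (simp add: finite_image_iff inj_on_subset)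
      ultimately show ?thesis using finite_subset by blast
    qed
    show "finite (P n)" for n
      using finite_lists_length_eq[of "UNIV :: bool set" n] by (simp add: P_def)
    show "partition_on UNIV (range P)"
    proof (rule partition_onI)
      show "\<Union>(range P) = UNIV"
      proof -
        have "\<Union>(range P) = range e" unfolding P_def by blast
        with surj show ?thesis by simp
      qed
      show "disjnt p q" if "p \<in> range P" "q \<in> range P" "p \<noteq> q" for p q
        using that by (auto simp: P_def disjnt_iff inj_eq[OF inj])
      have "e (replicate n True) \<in> P n" for n
        by (simp add: P_def)
      then show "{} \<notin> range P" by force
    qed
    show "\<exists>B\<in>(\<lambda>M. e ` B M) ` \<F>. finite (A \<inter> B)" if A: "\<And>n. card (A \<inter> P n) \<le> 1" for A
    proof -
      have "s = t" if "s \<in> e -` A" "t \<in> e -` A" "length s = length t" for s t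
      proof -
        \<comment> \<open>Finiteness matters because \<open>card\<close> is 0 on infinite sets; only
          with it does the bound 1 give uniqueness.\<close>
        have "finite (A \<inter> P (length s))"
          using finite_lists_length_eq[of "UNIV :: bool set" "length s"] by (simp add: P_def)
        moreover have "e s \<in> A \<inter> P (length s)" "e t \<in> A \<inter> P (length s)"
          using that by (auto simp: P_def)
        ultimately have "e s = e t"
          using A[of "length s"] card_le_Suc0_iff_eq by (metis One_nat_def)
        with inj show ?thesis by (rule injD)
      qed
      then obtain M where M: "M \<in> \<F>" "finite (e -` A \<inter> B M)"
        using B_selector by blast
      have "A \<inter> e ` B M \<subseteq> e ` (e -` A \<inter> B M)" by auto
      then have "finite (A \<inter> e ` B M)"
        using finite_imageI[OF M(2)] by (rule finite_subset)
      with M(1) show ?thesis by blast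
    qed
  qed
qed

subsection \<open>Finitely additive measures\<close>

text \<open>By Tychonoff the functions into \<open>{0..1}\<close> form a compact space. Additivity
  and each condition \<open>\<nu> A \<in> S\<close> define closed sets since evaluation at a set is
  continuous, so the finite intersection property applies.\<close>

lemma fa_measure_compactness:
  fixes K :: "(nat set \<times> real set) set"
  assumes closed: "\<And>A S. (A, S) \<in> K \<Longrightarrow> closed S"
    and fin: "\<And>K'. finite K' \<Longrightarrow> K' \<subseteq> K \<Longrightarrow>
      \<exists>\<nu>. \<nu> \<in> UNIV \<rightarrow> {0..1} \<and> additive UNIV \<nu> \<and> (\<forall>(A, S)\<in>K'. \<nu> A \<in> S)"
  shows "\<exists>\<nu>. \<nu> \<in> UNIV \<rightarrow> {0..1} \<and> additive UNIV \<nu> \<and> (\<forall>(A, S)\<in>K. \<nu> A \<in> S)"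
proof -
  define M where "M = {\<nu> :: nat set \<Rightarrow> real. \<nu> \<in> UNIV \<rightarrow> {0..1} \<and> additive UNIV \<nu>}"
  have "compact (Pi\<^sub>E UNIV (\<lambda>_ :: nat set. {0..1 :: real}))"
    using compactin_PiE[of "\<lambda>_. euclidean" UNIV "\<lambda>_ :: nat set. {0..1 :: real}"]
    by (simp add: euclidean_product_topology)
  moreover have "closed {\<nu> :: nat set \<Rightarrow> real. additive UNIV \<nu>}"
  proof -
    have "{\<nu> :: nat set \<Rightarrow> real. additive UNIV \<nu>} =
      (\<Inter>(X, Y)\<in>{(X, Y). X \<inter> Y = {}}. {\<nu>. \<nu> (X \<union> Y) = \<nu> X + \<nu> Y})"
      by (auto simp: additive_def)
    moreover have "closed {\<nu> :: nat set \<Rightarrow> real. \<nu> (X \<union> Y) = \<nu> X + \<nu> Y}" for X Y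
      by (intro closed_Collect_eq continuous_on_add continuous_on_product_coordinates)
    ultimately show ?thesis by auto
  qed
  moreover have "M = Pi\<^sub>E UNIV (\<lambda>_. {0..1}) \<inter> {\<nu>. additive UNIV \<nu>}"
    by (auto simp: M_def)
  ultimately have "compact M"
    using compact_Int_closed by metis
  moreover have "closed {\<nu> :: nat set \<Rightarrow> real. \<nu> (fst t) \<in> snd t}" if "t \<in> K" for t
  proof -
    have "closed (snd t)" using closed[of "fst t" "snd t"] that by simp
    then have "closed ((\<lambda>\<nu> :: nat set \<Rightarrow> real. \<nu> (fst t)) -` snd t)"
      by (intro closed_vimage continuous_on_product_coordinates)
    then show ?thesis by (simp add: vimage_def)
  qed
  moreover have "M \<inter> (\<Inter>t\<in>K'. {\<nu>. \<nu> (fst t) \<in> snd t}) \<noteq> {}" if K': "finite K'" "K' \<subseteq> K" for K'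
  proof -
    obtain \<nu> where "\<nu> \<in> UNIV \<rightarrow> {0..1}" "additive UNIV \<nu>" "\<forall>(A, S)\<in>K'. \<nu> A \<in> S"
      using fin[OF K'] by blast
    then have "\<nu> \<in> M \<inter> (\<Inter>t\<in>K'. {\<nu>. \<nu> (fst t) \<in> snd t})"
      unfolding M_def by (simp add: case_prod_unfold)
    then show ?thesis by blast
  qed
  ultimately have "M \<inter> (\<Inter>t\<in>K. {\<nu>. \<nu> (fst t) \<in> snd t}) \<noteq> {}"
    by (rule compact_imp_fip_image)
  then obtain \<nu> where "\<nu> \<in> M" "\<forall>t\<in>K. \<nu> (fst t) \<in> snd t" by blast
  then show ?thesis
    unfolding M_def by (intro exI[of _ \<nu>]) (simp add: case_prod_unfold)
qed

text \<open>By compactness it suffices to meet finitely many constraints. The point mass at a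
  \<open>p\<close> in the finite intersection, outside the finitely many finite sets to be made
  null, does so.\<close>

lemma fa_measure_of_filter_base:
  fixes \<G> :: "nat set set"
  assumes \<G>: "\<And>H. H \<subseteq> \<G> \<Longrightarrow> finite H \<Longrightarrow> infinite (\<Inter>H)"
  shows "\<exists>\<nu>. fa_measure_on UNIV \<nu> \<and> (\<forall>B\<in>\<G>. \<nu> B = 1)"
proof -
  define K where "K = (\<lambda>B. (B, {1 :: real})) ` \<G> \<union> (\<lambda>F. (F, {0})) ` {F :: nat set. finite F}"
  have "\<exists>\<nu>. \<nu> \<in> UNIV \<rightarrow> {0..1} \<and> additive UNIV \<nu> \<and> (\<forall>(A, S)\<in>K. \<nu> A \<in> S)"
  proof (rule fa_measure_compactness)
    show "closed S" if "(A, S) \<in> K" for A S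
      using that by (auto simp: K_def)
    fix K' assume K': "finite K'" "K' \<subseteq> K"
    define H where "H = \<G> \<inter> fst ` {t \<in> K'. snd t = {1}}"
    have "infinite (\<Inter>H)"
      using K'(1) by (intro \<G>) (auto simp: H_def)
    moreover have "finite (\<Union>(fst ` {t \<in> K'. snd t = {0}}))"
      using K' by (auto simp: K_def)
    ultimately have "infinite (\<Inter>H - \<Union>(fst ` {t \<in> K'. snd t = {0}}))"
      by simp
    then obtain p where p: "p \<in> \<Inter>H - \<Union>(fst ` {t \<in> K'. snd t = {0}})"
      using infinite_imp_nonempty by blast
    have "of_bool (p \<in> A) \<in> S" if t: "(A, S) \<in> K'" for A and S :: "real set"
    proof (cases "S = {0}")
      case True
      then have "p \<notin> A" using p t by force
      then show ?thesis using True by simp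
    next
      case False
      then have "S = {1}" "A \<in> \<G>" using t K'(2) by (auto simp: K_def)
      then have "A \<in> H" using t unfolding H_def by (auto intro!: image_eqI[of A fst "(A, S)"])
      then show ?thesis using p \<open>S = {1}\<close> by auto
    qed
    then show "\<exists>\<nu>. \<nu> \<in> UNIV \<rightarrow> {0..1} \<and> additive UNIV \<nu> \<and> (\<forall>(A, S)\<in>K'. \<nu> A \<in> S)"
      by (intro exI[of _ "\<lambda>A. of_bool (p \<in> A)"]) (auto simp: additive_def)
  qed
  then obtain \<nu> where \<nu>: "\<nu> \<in> UNIV \<rightarrow> {0..1}" "additive UNIV \<nu>"
    "\<And>A S. (A, S) \<in> K \<Longrightarrow> \<nu> A \<in> S"
    by blast
  have "\<nu> B = 1" if "B \<in> \<G>" for B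
    using \<nu>(3)[of B "{1}"] that by (simp add: K_def)
  moreover have "\<nu> F = 0" if "finite F" for F
    using \<nu>(3)[of F "{0}"] that by (simp add: K_def)
  ultimately show ?thesis
    using \<nu>(1,2) unfolding fa_measure_on_def by blast
qed

section \<open>Generated algebras and their density\<close>

text \<open>Complemented intersection alone generates the Boolean operations: applied to
  \<open>X\<close> and \<open>X\<close> it gives \<open>- X\<close>, and applied to complements it
  gives the union.\<close>

lemma algebra_binary_closure:
  fixes S :: "nat set set"
  assumes "{} \<in> S"
  shows "algebra UNIV (binary_closure (\<lambda>X Y. - (X \<inter> Y)) S)" (is "algebra UNIV ?B")
proof -
  have compl: "- X \<in> ?B" if "X \<in> ?B" for X
    using binary_closure.step[OF that that] by simp
  moreover have "X \<union> Y \<in> ?B" if "X \<in> ?B" "Y \<in> ?B" for X Y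
    using binary_closure.step[OF compl compl, OF that] by simp
  moreover have "{} \<in> ?B"
    using assms by (rule binary_closure.base)
  ultimately show ?thesis
    by (auto simp: algebra_iff_Un Compl_eq_Diff_UNIV)
qed

lemma algebra_density_le: "algebra_density \<B> \<le>o |\<B>|"
proof -
  have "algebra_density \<B> \<le>o |{A \<in> \<B>. infinite A}|"
    unfolding algebra_density_def
    using least_card(2)[of "{\<A>. dense_family \<B> \<A>}"] dense_family_all[of \<B>] by blast
  moreover have "|{A \<in> \<B>. infinite A}| \<le>o |\<B>|"
    by (rule card_of_mono1) auto
  ultimately show ?thesis by (rule ordLeq_transitive)
qed

lemma algebra_density_witness:
  obtains \<A> where "dense_family \<B> \<A>" "algebra_density \<B> = |\<A>|"
  using least_card(1)[of "{\<A>. dense_family \<B> \<A>}"] dense_family_all[of \<B>]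
  unfolding algebra_density_def by blast

subsection \<open>Generic gap sets and the extension\<close>

definition gap_above :: "(nat \<Rightarrow> nat) \<Rightarrow> nat set \<Rightarrow> bool" where
  "gap_above g R \<longleftrightarrow> (\<forall>a\<in>R. \<forall>b\<in>R. a < b \<longrightarrow> g a < b)"

text \<open>\<open>R x\<close> keeps those ones of \<open>x\<close> that lie above
  \<open>g b\<close> for all earlier ones \<open>b\<close>, so it has the gap property for every
  \<open>x\<close>. A finite condition of length \<open>n\<close> is extended by zeros up to a large
  \<open>a\<close> in \<open>A\<close> and a one at \<open>a\<close>, which puts \<open>a\<close>
  into \<open>R x\<close>.\<close>

lemma generic_gap_set:
  fixes \<A> :: "nat set set"
  assumes "|\<A>| <o cov_meager"
  shows "\<exists>R. gap_above g R \<and> (\<forall>A\<in>\<A>. infinite A \<longrightarrow> infinite (A \<inter> R))"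
proof -
  define R where "R x = {a. x a \<and> (\<forall>b<a. x b \<longrightarrow> g b < a)}" for x :: "nat \<Rightarrow> bool"
  have "|{A \<in> \<A>. infinite A}| \<le>o |\<A>|"
    by (rule card_of_mono1) auto
  then have "|{A \<in> \<A>. infinite A}| <o cov_meager"
    using assms ordLeq_ordLess_trans by blast
  then have "\<exists>x. \<forall>A\<in>{A \<in> \<A>. infinite A}. \<forall>m. x \<in> {x. \<exists>a\<in>A. m \<le> a \<and> a \<in> R x}"
  proof (rule cov_meager_generic)
    fix A m x n assume "A \<in> {A \<in> \<A>. infinite A}"
    then have "infinite A" by simp
    then obtain a where a: "a \<in> A" "m + n + (\<Sum>b<n. g b) < a"
      unfolding infinite_nat_iff_unbounded by blast
    have g: "g b < a" if "b < n" for b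
      using member_le_sum[of b "{..<n}" g] that a(2) by simp
    define y where "y k \<longleftrightarrow> (if k < n then x k else k = a)" for k
    have "y \<in> cyl x n" by (simp add: cyl_def y_def)
    moreover have "a \<in> R z" if "z \<in> cyl y (Suc a)" for z
    proof -
      have z: "z k = y k" if "k \<le> a" for k
        using \<open>z \<in> cyl y (Suc a)\<close> that by (simp add: cyl_def)
      have "z a" using z[of a] a(2) by (simp add: y_def)
      moreover have "g b < a" if "b < a" "z b" for b
        using g[of b] z[of b] that by (simp add: y_def split: if_splits)
      ultimately show ?thesis by (simp add: R_def)
    qed
    then have "cyl y (Suc a) \<subseteq> {x. \<exists>a\<in>A. m \<le> a \<and> a \<in> R x}"
      using a by (auto intro!: bexI[of _ a])
    ultimately show "\<exists>y\<in>cyl x n. \<exists>l. cyl y l \<subseteq> {x. \<exists>a\<in>A. m \<le> a \<and> a \<in> R x}"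
      by blast
  qed
  then obtain x where x: "\<And>A m. A \<in> \<A> \<Longrightarrow> infinite A \<Longrightarrow> \<exists>a\<in>A. m \<le> a \<and> a \<in> R x"
    by auto
  have "infinite (A \<inter> R x)" if "A \<in> \<A>" "infinite A" for A
    unfolding infinite_nat_iff_unbounded_le using x[OF that] by blast
  moreover have "gap_above g (R x)"
    by (auto simp: gap_above_def R_def)
  ultimately show ?thesis by blast
qed

lemma generic_colouring:
  fixes \<A> :: "nat set set"
  assumes "|\<A>| <o cov_meager" and inf: "\<And>A. A \<in> \<A> \<Longrightarrow> infinite A"
  shows "\<exists>c :: nat \<Rightarrow> nat. \<forall>A\<in>\<A>. \<forall>j. infinite {k \<in> A. c k = j}"
proof -
  \<comment> \<open>\<open>x\<close> is read as an array, and the colour of \<open>k\<close> is the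
    place of the first \<open>False\<close> in row \<open>k\<close>. The unspecified colour of a row
    without \<open>False\<close> is harmless: only the occurrence of colours is asserted.\<close>
  define c where "c x k = (LEAST j. \<not> x (prod_encode (k, j)))" for x :: "nat \<Rightarrow> bool" and k
  \<comment> \<open>\<open>N\<close> codes a colour and a lower bound, so that all requirements for
    one \<open>A\<close> are indexed by numbers.\<close>
  define U where "U A N = {x. \<exists>k\<in>A. snd (prod_decode N) \<le> k \<and> c x k = fst (prod_decode N)}"
    for A N
  have "\<exists>x. \<forall>A\<in>\<A>. \<forall>N. x \<in> U A N"
    using assms(1)
  proof (rule cov_meager_generic)
    fix A N x n assume A: "A \<in> \<A>"
    obtain j m where jm: "prod_decode N = (j, m)" by fastforce
    obtain k where k: "k \<in> A" "m + n < k"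
      using inf[OF A] unfolding infinite_nat_iff_unbounded by blast
    \<comment> \<open>The whole row \<open>k\<close> lies beyond the bits already fixed, so it can
      be filled freely.\<close>
    have enc: "\<not> prod_encode (k, i) < n" for i
      using k(2) le_prod_encode_1[of k i] by simp
    define y where "y t \<longleftrightarrow> (if t < n then x t else t \<noteq> prod_encode (k, j))" for t
    define l where "l = Suc (\<Sum>i\<le>j. prod_encode (k, i))"
    have "y \<in> cyl x n" by (simp add: cyl_def y_def)
    moreover have "c z k = j" if "z \<in> cyl y l" for z
    proof -
      have z: "z (prod_encode (k, i)) \<longleftrightarrow> i \<noteq> j" if "i \<le> j" for i
      proof -
        have "prod_encode (k, i) < l"
          using member_le_sum[of i "{..j}" "\<lambda>i. prod_encode (k, i)"] that by (simp add: l_def)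
        then show ?thesis
          using \<open>z \<in> cyl y l\<close> enc by (simp add: cyl_def y_def)
      qed
      show ?thesis
        unfolding c_def
      proof (rule Least_equality)
        show "\<not> z (prod_encode (k, j))" using z by simp
        show "j \<le> i" if "\<not> z (prod_encode (k, i))" for i
          using z[of i] that by (cases "i \<le> j") auto
      qed
    qed
    then have "cyl y l \<subseteq> U A N"
      using k by (auto simp: U_def jm intro!: bexI[of _ k])
    ultimately show "\<exists>y\<in>cyl x n. \<exists>l. cyl y l \<subseteq> U A N" by blast
  qed
  then obtain x where x: "\<And>A N. A \<in> \<A> \<Longrightarrow> x \<in> U A N" by blast
  have "infinite {k \<in> A. c x k = j}" if "A \<in> \<A>" for A j
    unfolding infinite_nat_iff_unbounded_le
  proof
    fix m
    show "\<exists>k\<ge>m. k \<in> {k \<in> A. c x k = j}"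
      using x[OF that, of "prod_encode (j, m)"] by (auto simp: U_def)
  qed
  then show ?thesis by blast
qed

lemma finite_linear_order_max:
  assumes "Linear_order r" "finite H" "H \<noteq> {}" "H \<subseteq> Field r"
  shows "\<exists>m\<in>H. \<forall>h\<in>H. (h, m) \<in> r"
  using assms(2,3,4)
proof (induction H rule: finite_ne_induct)
  case (singleton x)
  then show ?case
    using assms(1) by (auto simp: order_on_defs refl_on_def)
next
  case (insert x H)
  then obtain m where m: "m \<in> H" "\<forall>h\<in>H. (h, m) \<in> r" by auto
  have r: "refl_on (Field r) r" "trans r" "total_on (Field r) r"
    using assms(1) unfolding order_on_defs by blast+
  show ?case
  proof (cases "(x, m) \<in> r")
    case True
    then show ?thesis using m by blast
  next
    case False
    then have "x \<noteq> m" using r(1) m(1) insert.prems by (auto simp: refl_on_def)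
    with False have "(m, x) \<in> r"
      using r(3) m(1) insert.prems unfolding total_on_def by blast
    moreover have "(x, x) \<in> r"
      using r(1) insert.prems by (auto simp: refl_on_def)
    ultimately show ?thesis
      using m(2) transD[OF r(2)] by (intro bexI[of _ x]) blast+
  qed
qed

text \<open>Proper initial segments of the cardinal order on \<open>D\<close> are smaller than
  \<open>cov_meager\<close>, and so is the closure \<open>C R g\<close> of the sets at hand under
  intersection. Hence \<open>R g\<close> can be chosen to meet all its infinite members in infinite
  sets.\<close>

lemma generic_gap_sets:
  fixes \<A> :: "nat set set"
  assumes eq: "dominating_number =o cov_meager" and D: "dominating_number = |D|"
    and \<A>: "|\<A>| <o dominating_number" "\<And>A. A \<in> \<A> \<Longrightarrow> infinite A"
  shows "\<exists>R. (\<forall>g\<in>D. gap_above g (R g)) \<and>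
    (\<forall>A\<in>\<A>. \<forall>H. finite H \<and> H \<subseteq> D \<longrightarrow> infinite (A \<inter> \<Inter>(R ` H)))"
proof -
  define r where "r = |D|"
  have r: "Card_order r" "Field r = D" "Well_order r"
    unfolding r_def by (rule card_of_Card_order Field_card_of card_of_Well_order)+
  define C where "C R g = binary_closure (\<inter>) (\<A> \<union> R ` underS r g)" for R g
  \<comment> \<open>\<open>R\<close> enters only through its values strictly below \<open>g\<close>,
    as the recursion demands. Off \<open>D\<close> the requirement is vacuous, so a choice exists
    for every \<open>g\<close>.\<close>
  define Q where "Q R g S \<longleftrightarrow> (g \<in> D \<longrightarrow> gap_above g S \<and>
    (\<forall>A\<in>C R g. infinite A \<longrightarrow> infinite (A \<inter> S)))" for R g S
  have "\<exists>R. \<forall>g. Q R g (R g)"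
  proof (rule dependent_wf_choice)
    show "wf (r - Id)"
      using r(3) by (simp add: well_order_on_def)
    show "Q f x S = Q g x S" if "\<And>z. (z, x) \<in> r - Id \<Longrightarrow> f z = g z" for f g x S
    proof -
      have "f ` underS r x = g ` underS r x"
        using that by (intro image_cong) (auto simp: underS_def)
      then show ?thesis by (simp add: Q_def C_def)
    qed
    show "\<exists>S. Q R g S" for g R
    proof (cases "g \<in> D")
      case True
      have "|underS r g| <o dominating_number"
        using card_of_underS[OF r(1), of g] True r(2) D by (simp add: r_def)
      then have "|C R g| <o dominating_number"
        unfolding C_def using \<A>(1)
        by (intro binary_closure_less_dominating_number Un_less_dominating_number
            image_less_dominating_number)
      then have "|C R g| <o cov_meager"
        using eq ordLess_ordIso_trans by blast
      then show ?thesis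
        unfolding Q_def using generic_gap_set by blast
    qed (simp add: Q_def)
  qed
  then obtain R where R: "\<And>g. Q R g (R g)" by blast
  have "infinite (A \<inter> \<Inter>(R ` H))" if A: "A \<in> \<A>" and "finite H" "H \<subseteq> D" for A H
    using \<open>finite H\<close> \<open>H \<subseteq> D\<close>
  proof (induction H rule: finite_psubset_induct)
    case (psubset H)
    show ?case
    proof (cases "H = {}")
      case True
      then show ?thesis using \<A>(2)[OF A] by simp
    next
      case False
      have "Linear_order r" using r(3) by (simp add: well_order_on_def)
      \<comment> \<open>All other members of \<open>H\<close> precede this \<open>g\<close>, so the
        intersection belonging to them is one of the sets that \<open>R g\<close> was chosen to
        meet.\<close>
      then obtain g where g: "g \<in> H" "\<forall>h\<in>H. (h, g) \<in> r"
        using finite_linear_order_max[of r H] False psubset r(2) by auto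
      have "infinite (A \<inter> \<Inter>(R ` (H - {g})))"
        using g(1) psubset.prems by (intro psubset.IH) auto
      moreover have "A \<inter> \<Inter>(R ` H') \<in> C R g" if "finite H'" "H' \<subseteq> underS r g" for H'
        using that
      proof (induction H' rule: finite_induct)
        case empty
        then show ?case using A by (auto simp: C_def intro: binary_closure.base)
      next
        case (insert h H')
        then have "R h \<in> C R g" by (auto simp: C_def intro: binary_closure.base)
        with insert have "(A \<inter> \<Inter>(R ` H')) \<inter> R h \<in> C R g"
          unfolding C_def by (metis binary_closure.step insert_subset)
        moreover have "A \<inter> \<Inter>(R ` insert h H') = (A \<inter> \<Inter>(R ` H')) \<inter> R h" by auto
        ultimately show ?case by simp
      qed
      then have "A \<inter> \<Inter>(R ` (H - {g})) \<in> C R g"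
        using g psubset.hyps by (auto simp: underS_def)
      ultimately have "infinite (A \<inter> \<Inter>(R ` (H - {g})) \<inter> R g)"
        using R[of g] g(1) psubset.prems unfolding Q_def by blast
      moreover have "A \<inter> \<Inter>(R ` (H - {g})) \<inter> R g = A \<inter> \<Inter>(R ` H)"
        using g(1) by auto
      ultimately show ?thesis by simp
    qed
  qed
  moreover have "gap_above g (R g)" if "g \<in> D" for g
    using R[of g] that by (simp add: Q_def)
  ultimately show ?thesis by blast
qed

section \<open>Extending the measure\<close>

lemma (in ring_of_sets) additive_finite_sum:
  fixes f :: "'a set \<Rightarrow> real"
  assumes f: "additive M f" "f {} = 0"
    and I: "finite I" "X ` I \<subseteq> M" "disjoint_family_on X I"
  shows "f (\<Union>i\<in>I. X i) = (\<Sum>i\<in>I. f (X i))"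
  using I
proof (induction I rule: finite_induct)
  case empty
  then show ?case using f(2) by simp
next
  case (insert i I)
  have "X i \<inter> (\<Union>j\<in>I. X j) = {}"
    using insert.hyps(2) insert.prems(2) by (auto simp: disjoint_family_on_def)
  moreover have "X i \<in> M" "(\<Union>j\<in>I. X j) \<in> M"
    using insert by auto
  ultimately have "f (X i \<union> (\<Union>j\<in>I. X j)) = f (X i) + f (\<Union>j\<in>I. X j)"
    by (rule additiveD[OF f(1)])
  moreover have "f (\<Union>j\<in>I. X j) = (\<Sum>j\<in>I. f (X j))"
    using insert.prems by (intro insert.IH) (auto simp: disjoint_family_on_def)
  ultimately show ?case using insert.hyps by simp
qed

text \<open>\<open>\<nu>\<close> is a finite sum of point masses. Every cell of the partition
  generated by \<open>\<B>0\<close> spreads its mass equally over \<open>2 ^ N\<close> points of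
  \<open>Z\<close> with colours \<open>0, ..., 2 ^ N - 1\<close>. Values on \<open>\<B>0\<close> are
  preserved, all mass sits in \<open>Z\<close>, and residue classes of colours receive equal
  shares.\<close>

lemma fa_measure_finite_approximation:
  fixes \<mu> :: "nat set \<Rightarrow> real" and c :: "nat \<Rightarrow> nat"
  assumes alg: "algebra UNIV \<B>" and \<mu>: "fa_measure_on \<B> \<mu>"
    and \<B>0: "finite \<B>0" "\<B>0 \<subseteq> \<B>"
    and Z: "\<And>B j. B \<in> \<B> \<Longrightarrow> infinite B \<Longrightarrow> infinite {k \<in> B \<inter> Z. c k = j}"
  shows "\<exists>\<nu>. \<nu> \<in> UNIV \<rightarrow> {0..1} \<and> additive UNIV \<nu> \<and> (\<forall>B\<in>\<B>0. \<nu> B = \<mu> B) \<and>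
    (\<forall>X. Z \<subseteq> X \<longrightarrow> \<nu> X = \<mu> UNIV) \<and>
    (\<forall>n\<le>N. \<forall>i. \<nu> {k. c k mod 2 ^ n = i} \<le> 1 / 2 ^ n)"
proof -
  interpret algebra UNIV \<B> by (rule alg)
  define cell where "cell S = {q. \<forall>B\<in>\<B>0. q \<in> B \<longleftrightarrow> B \<in> S}" for S
  define \<T> where "\<T> = cell ` Pow \<B>0"
  have "finite \<T>" using \<B>0(1) by (simp add: \<T>_def)
  have cell_in: "cell S \<in> \<B>" for S
  proof -
    have "{q \<in> UNIV. q \<in> B \<longleftrightarrow> B \<in> S} \<in> \<B>" if "B \<in> \<B>0" for B
    proof -
      have "{q \<in> UNIV. q \<in> B \<longleftrightarrow> B \<in> S} = (if B \<in> S then B else UNIV - B)" by auto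
      then show ?thesis using that \<B>0(2) by auto
    qed
    then have "{q \<in> UNIV. \<forall>B\<in>\<B>0. q \<in> B \<longleftrightarrow> B \<in> S} \<in> \<B>"
      using \<B>0(1) by (rule sets_Collect_finite_All)
    then show ?thesis by (simp add: cell_def)
  qed
  then have \<T>_sub: "\<T> \<subseteq> \<B>" by (auto simp: \<T>_def)
  have \<T>_disj: "T \<inter> T' = {}" if "T \<in> \<T>" "T' \<in> \<T>" "T \<noteq> T'" for T T'
  proof -
    obtain S S' where S: "S \<subseteq> \<B>0" "T = cell S" "S' \<subseteq> \<B>0" "T' = cell S'"
      using \<open>T \<in> \<T>\<close> \<open>T' \<in> \<T>\<close> by (auto simp: \<T>_def)
    have "S = S'" if "q \<in> T" "q \<in> T'" for q
      using that S by (auto simp: cell_def)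
    then show ?thesis using S \<open>T \<noteq> T'\<close> by blast
  qed
  have \<T>_cover: "\<Union>\<T> = UNIV"
  proof -
    have "q \<in> cell {B \<in> \<B>0. q \<in> B}" for q by (simp add: cell_def)
    moreover have "cell {B \<in> \<B>0. q \<in> B} \<in> \<T>" for q
      unfolding \<T>_def by (intro imageI) auto
    ultimately have "q \<in> \<Union>\<T>" for q by (rule UnionI[rotated])
    then show ?thesis by blast
  qed
  have \<T>_dec: "T \<subseteq> B \<or> T \<inter> B = {}" if "T \<in> \<T>" "B \<in> \<B>0" for T B
    using that by (auto simp: \<T>_def cell_def)
  have \<mu>_empty: "\<mu> {} = 0" and \<mu>_fin: "\<And>F. F \<in> \<B> \<Longrightarrow> finite F \<Longrightarrow> \<mu> F = 0"
    and \<mu>_range: "\<And>B. B \<in> \<B> \<Longrightarrow> 0 \<le> \<mu> B \<and> \<mu> B \<le> 1"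
    using \<mu> empty_sets by (auto simp: fa_measure_on_def)
  have \<mu>_sum: "(\<Sum>T\<in>\<S>. \<mu> T) = \<mu> (\<Union>\<S>)" if "\<S> \<subseteq> \<T>" for \<S>
  proof -
    have "\<mu> (\<Union>T\<in>\<S>. id T) = (\<Sum>T\<in>\<S>. \<mu> (id T))"
    proof (rule additive_finite_sum)
      show "additive \<B> \<mu>" using \<mu> by (simp add: fa_measure_on_def)
      show "\<mu> {} = 0" by (rule \<mu>_empty)
      show "finite \<S>" using that \<open>finite \<T>\<close> by (rule finite_subset)
      show "id ` \<S> \<subseteq> \<B>" using that \<T>_sub by simp
      show "disjoint_family_on id \<S>"
        unfolding disjoint_family_on_def using \<T>_disj that by auto
    qed
    then show ?thesis by simp
  qed
  have \<mu>_UNIV: "(\<Sum>T\<in>\<T>. \<mu> T) = \<mu> UNIV"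
    using \<mu>_sum[of \<T>] \<T>_cover by simp

  \<comment> \<open>A cell of nonzero mass is infinite, so such points exist in it. In null cells
    the choice may be arbitrary, but it carries weight 0.\<close>
  define p where "p T i = (SOME k. k \<in> T \<inter> Z \<and> c k = i)" for T i
  have p: "p T i \<in> T \<inter> Z \<and> c (p T i) = i" if "T \<in> \<T>" "\<mu> T \<noteq> 0" for T i
  proof -
    have "T \<in> \<B>" using that(1) \<T>_sub by blast
    moreover from this have "infinite T" using that(2) \<mu>_fin by blast
    ultimately have "infinite {k \<in> T \<inter> Z. c k = i}" by (rule Z)
    then have "\<exists>k. k \<in> T \<inter> Z \<and> c k = i"
      using infinite_imp_nonempty by blast
    then show ?thesis unfolding p_def by (rule someI_ex)
  qed
  define m where "m T X = (\<Sum>i<2 ^ N. \<mu> T / 2 ^ N * of_bool (p T i \<in> X))" for T X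
  define \<nu> where "\<nu> X = (\<Sum>T\<in>\<T>. m T X)" for X
  have m_all: "m T X = \<mu> T" if "\<And>i. \<mu> T \<noteq> 0 \<Longrightarrow> p T i \<in> X" for T X
    using that by (cases "\<mu> T = 0") (simp_all add: m_def)
  have m_none: "m T X = 0" if "\<And>i. \<mu> T \<noteq> 0 \<Longrightarrow> p T i \<notin> X" for T X
    using that by (cases "\<mu> T = 0") (simp_all add: m_def)
  have m_nonneg: "0 \<le> m T X" if "T \<in> \<T>" for T X
    unfolding m_def using that \<T>_sub \<mu>_range by (intro sum_nonneg) auto
  have m_add: "m T (X \<union> Y) = m T X + m T Y" if "X \<inter> Y = {}" for T X Y
    unfolding m_def sum.distrib[symmetric] using that
    by (intro sum.cong refl) (auto simp: of_bool_def)
  have "additive UNIV \<nu>"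
    by (auto simp: additive_def \<nu>_def m_add sum.distrib)
  have \<nu>_full: "\<nu> X = \<mu> UNIV" if "Z \<subseteq> X" for X
    unfolding \<nu>_def \<mu>_UNIV[symmetric] using that p by (intro sum.cong refl m_all) blast
  have "0 \<le> \<nu> X" for X
    unfolding \<nu>_def by (intro sum_nonneg m_nonneg)
  moreover have "\<nu> X \<le> 1" for X
  proof -
    have "\<nu> UNIV = \<nu> X + \<nu> (- X)"
      using additiveD[OF \<open>additive UNIV \<nu>\<close>, of X "- X"] by simp
    moreover have "\<nu> UNIV \<le> 1"
      using \<nu>_full[of UNIV] \<mu>_range[of UNIV] top by simp
    ultimately show ?thesis using \<open>\<And>X. 0 \<le> \<nu> X\<close>[of "- X"] by simp
  qed
  moreover have "\<nu> B = \<mu> B" if "B \<in> \<B>0" for B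
  proof -
    have "\<nu> B = (\<Sum>T\<in>\<T>. if T \<subseteq> B then \<mu> T else 0)"
      unfolding \<nu>_def
    proof (intro sum.cong refl)
      fix T assume T: "T \<in> \<T>"
      show "m T B = (if T \<subseteq> B then \<mu> T else 0)"
      proof (cases "T \<subseteq> B")
        case True
        then have "m T B = \<mu> T" using p[OF T] by (intro m_all) blast
        then show ?thesis using True by simp
      next
        case False
        then have "m T B = 0" using p[OF T] \<T>_dec[OF T that] by (intro m_none) blast
        then show ?thesis using False by simp
      qed
    qed
    also have "\<dots> = (\<Sum>T\<in>{T \<in> \<T>. T \<subseteq> B}. \<mu> T)"
      using \<open>finite \<T>\<close> by (simp add: sum.inter_filter)
    also have "\<dots> = \<mu> (\<Union>{T \<in> \<T>. T \<subseteq> B})"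
      by (rule \<mu>_sum) auto
    also have "\<Union>{T \<in> \<T>. T \<subseteq> B} = B"
      using \<T>_cover \<T>_dec[OF _ that] by blast
    finally show ?thesis .
  qed
  moreover have "\<nu> {k. c k mod 2 ^ n = i} \<le> 1 / 2 ^ n" if n: "n \<le> N" for n i
  proof -
    have "m T {k. c k mod 2 ^ n = i} \<le> \<mu> T / 2 ^ n" if T: "T \<in> \<T>" for T
    proof (cases "\<mu> T = 0")
      case True
      then show ?thesis by (simp add: m_def)
    next
      case False
      have pow: "(2 :: nat) ^ N = 2 ^ n * 2 ^ (N - n)" "(2 :: real) ^ N = 2 ^ n * 2 ^ (N - n)"
        using n by (simp_all flip: power_add)
      \<comment> \<open>At most \<open>2 ^ (N - n)\<close> of the \<open>2 ^ N\<close> colours are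
        congruent to \<open>i\<close>, each with weight \<open>\<mu> T / 2 ^ N\<close>.\<close>
      have "{j. j < 2 ^ N \<and> j mod 2 ^ n = i} \<subseteq> (\<lambda>q. i + 2 ^ n * q) ` {..<2 ^ (N - n)}"
      proof
        fix j assume "j \<in> {j. j < 2 ^ N \<and> j mod 2 ^ n = i}"
        then have j: "j < 2 ^ N" "j mod 2 ^ n = i" by auto
        have "j div 2 ^ n < 2 ^ (N - n)"
          using j(1) by (simp add: pow(1) less_mult_imp_div_less mult.commute)
        moreover have "j = i + 2 ^ n * (j div 2 ^ n)"
          using j(2) by (metis mod_mult_div_eq)
        ultimately show "j \<in> (\<lambda>q. i + 2 ^ n * q) ` {..<2 ^ (N - n)}" by blast
      qed
      then have "card {j. j < 2 ^ N \<and> j mod 2 ^ n = i} \<le> card {..<(2 :: nat) ^ (N - n)}"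
        by (intro surj_card_le) simp_all
      then have card: "real (card {j. j < 2 ^ N \<and> j mod 2 ^ n = i}) \<le> 2 ^ (N - n)"
        using of_nat_mono[where 'a = real] by fastforce
      have "m T {k. c k mod 2 ^ n = i} = (\<Sum>j<2 ^ N. \<mu> T / 2 ^ N * of_bool (j mod 2 ^ n = i))"
        unfolding m_def using p[OF T False] by simp
      also have "\<dots> = \<mu> T / 2 ^ N * real (card {j. j < 2 ^ N \<and> j mod 2 ^ n = i})"
        unfolding sum_distrib_left[symmetric] by (subst sum_of_bool_eq) (simp_all add: Int_def)
      also have "\<dots> \<le> \<mu> T / 2 ^ N * 2 ^ (N - n)"
        using card \<mu>_range[of T] T \<T>_sub by (intro mult_left_mono) auto
      also have "\<dots> = \<mu> T / 2 ^ n"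
        by (simp add: pow(2))
      finally show ?thesis .
    qed
    then have "\<nu> {k. c k mod 2 ^ n = i} \<le> (\<Sum>T\<in>\<T>. \<mu> T / 2 ^ n)"
      unfolding \<nu>_def by (rule sum_mono)
    also have "\<dots> = \<mu> UNIV / 2 ^ n"
      by (simp add: \<mu>_UNIV flip: sum_divide_distrib)
    also have "\<dots> \<le> 1 / 2 ^ n"
      using \<mu>_range[of UNIV] top by (simp add: divide_right_mono)
    finally show ?thesis .
  qed
  ultimately show ?thesis
    using \<open>additive UNIV \<nu>\<close> \<nu>_full by (intro exI[of _ \<nu>]) auto
qed

text \<open>Once \<open>1 / 2 ^ n < \<nu> A\<close>, the colours modulo \<open>2 ^ n\<close> split
  \<open>A\<close> into pieces of measure below \<open>\<nu> A\<close>. They sum to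
  \<open>\<nu> A\<close>, so one of them is not null.\<close>

lemma atomless_if_small_partitions:
  fixes \<nu> :: "nat set \<Rightarrow> real"
  assumes \<nu>: "fa_measure_on UNIV \<nu>"
    and c: "\<And>n i. \<nu> {k. c k mod 2 ^ n = (i :: nat)} \<le> 1 / 2 ^ n"
  shows "atomless \<nu>"
  unfolding atomless_def
proof (intro allI impI)
  fix A assume A: "0 < \<nu> A"
  have add: "additive UNIV \<nu>" "\<nu> {} = 0" "\<And>X. 0 \<le> \<nu> X"
    using \<nu> by (auto simp: fa_measure_on_def)
  obtain n where "(1 / 2) ^ n < \<nu> A"
    using real_arch_pow_inv[OF A, of "1 / 2"] by auto
  then have n: "1 / 2 ^ n < \<nu> A" by (simp add: power_one_over)
  define X where "X i = {k \<in> A. c k mod 2 ^ n = i}" for i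
  have "A = (\<Union>i<2 ^ n. X i)" by (auto simp: X_def)
  then have "\<nu> A = (\<Sum>i<2 ^ n. \<nu> (X i))"
    using ring_of_sets.additive_finite_sum[OF _ add(1,2), of UNIV "{..<2 ^ n}" X]
      algebra_Pow[of "UNIV :: nat set"]
    by (auto simp: disjoint_family_on_def X_def algebra_def)
  then obtain i where i: "0 < \<nu> (X i)"
    using A sum_nonpos[of "{..<2 ^ n}" "\<lambda>i. \<nu> (X i)"] by (metis linorder_not_less)
  have "{k. c k mod 2 ^ n = i} = X i \<union> ({k. c k mod 2 ^ n = i} - A)" by (auto simp: X_def)
  then have "\<nu> {k. c k mod 2 ^ n = i} = \<nu> (X i) + \<nu> ({k. c k mod 2 ^ n = i} - A)"
    using additiveD[OF add(1), of "X i" "{k. c k mod 2 ^ n = i} - A"] by (auto simp: X_def)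
  then have "\<nu> (X i) < \<nu> A"
    using add(3)[of "{k. c k mod 2 ^ n = i} - A"] c[of n i] n by simp
  then show "\<exists>B\<subseteq>A. 0 < \<nu> B \<and> \<nu> B < \<nu> A"
    using i by (intro exI[of _ "X i"]) (auto simp: X_def)
qed

text \<open>Let \<open>f k\<close> be the maximum of the block of \<open>k\<close>, dominated by
  \<open>g\<close> from \<open>k0\<close> on. Elements \<open>x < y\<close> of \<open>R g\<close>
  beyond \<open>k0\<close> in one block would satisfy \<open>y \<le> f x < g x < y\<close>. Dropping
  the finite part below \<open>k0\<close> costs no measure.\<close>

lemma strong_Q_measure_if_gap_sets:
  assumes \<nu>: "fa_measure_on UNIV \<nu>" and D: "dominating D"
    and R: "\<And>g. g \<in> D \<Longrightarrow> gap_above g (R g) \<and> \<nu> (R g) = \<nu> UNIV"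
  shows "strong_Q_measure \<nu>"
  unfolding strong_Q_measure_def
proof (intro conjI allI impI)
  show "fa_measure_on UNIV \<nu>" by (rule \<nu>)
  fix P :: "nat \<Rightarrow> nat set"
  assume "partition_on UNIV (range P) \<and> (\<forall>n. finite (P n))"
  then have cover: "\<Union>(range P) = UNIV" and fin: "\<And>n. finite (P n)"
    and disj: "\<And>m n k. k \<in> P m \<Longrightarrow> k \<in> P n \<Longrightarrow> P m = P n"
    by (auto simp: partition_on_def disjoint_def)
  have "\<forall>k. \<exists>n. k \<in> P n" using cover by blast
  then obtain b where b: "\<And>k. k \<in> P (b k)" by metis
  define f where "f k = Max (P (b k))" for k
  obtain g k0 where g: "g \<in> D" "\<And>k. k0 \<le> k \<Longrightarrow> f k < g k"
    using D unfolding dominating_def eventually_sequentially by metis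
  define A where "A = R g - {..<k0}"
  have "R g = A \<union> (R g \<inter> {..<k0})" by (auto simp: A_def)
  then have "\<nu> (R g) = \<nu> A + \<nu> (R g \<inter> {..<k0})"
    using \<nu> additiveD[of UNIV \<nu> A "R g \<inter> {..<k0}"] by (auto simp: fa_measure_on_def A_def)
  moreover have "\<nu> (R g \<inter> {..<k0}) = 0"
    using \<nu> by (auto simp: fa_measure_on_def)
  ultimately have "\<nu> A = \<nu> UNIV" using R[OF g(1)] by simp
  moreover have "card (A \<inter> P n) \<le> 1" for n
  proof -
    have *: False if "x \<in> A \<inter> P n" "y \<in> A \<inter> P n" "x < y" for x y
    proof -
      have "y \<in> P (b x)" using disj[OF b[of x], of n] that by blast
      then have "y \<le> f x" using fin by (simp add: f_def)
      moreover have "f x < g x" using that(1) by (intro g(2)) (simp add: A_def)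
      moreover have "g x < y"
        using R[OF g(1)] that by (auto simp: gap_above_def A_def)
      ultimately show False by simp
    qed
    have "x = y" if "x \<in> A \<inter> P n" "y \<in> A \<inter> P n" for x y
      using *[OF that] *[OF that(2,1)] by (metis linorder_neqE_nat)
    then show ?thesis using fin by (simp add: card_le_Suc0_iff_eq)
  qed
  ultimately show "\<exists>A. \<nu> UNIV \<le> \<nu> A \<and> (\<forall>n. card (A \<inter> P n) \<le> 1)"
    by (intro exI[of _ A]) simp
qed

lemma strong_Q_extension:
  fixes \<mu> :: "nat set \<Rightarrow> real"
  assumes eq: "dominating_number =o cov_meager"
    and alg: "algebra UNIV \<B>" and fin: "{F. finite F} \<subseteq> \<B>" and \<mu>: "fa_measure_on \<B> \<mu>"
    and dens: "algebra_density \<B> <o dominating_number"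
  shows "\<exists>\<nu>. atomless \<nu> \<and> strong_Q_measure \<nu> \<and> (\<forall>B\<in>\<B>. \<nu> B = \<mu> B)"
proof -
  obtain \<A> where \<A>: "dense_family \<B> \<A>" "algebra_density \<B> = |\<A>|"
    by (rule algebra_density_witness)
  then have small: "|\<A>| <o dominating_number" using dens by simp
  have \<A>_inf: "infinite A" if "A \<in> \<A>" for A
    using \<A>(1) that unfolding dense_family_def by blast
  obtain c :: "nat \<Rightarrow> nat" where c: "\<And>A j. A \<in> \<A> \<Longrightarrow> infinite {k \<in> A. c k = j}"
    using generic_colouring[of \<A>] ordLess_ordIso_trans[OF small eq] \<A>_inf by blast
  \<comment> \<open>Colour classes replace the members of the dense family, so that the gap sets
    meet every colour inside every infinite member of \<open>\<B>\<close>.\<close>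
  define \<A>' where "\<A>' = (\<lambda>(A, j). {k \<in> A. c k = j}) ` (\<A> \<times> UNIV)"
  have \<A>'_small: "|\<A>'| <o dominating_number"
    unfolding \<A>'_def using small
    by (intro image_less_dominating_number Times_nat_less_dominating_number)
  have \<A>'_inf: "infinite A" if "A \<in> \<A>'" for A
    using c that unfolding \<A>'_def by auto
  obtain D where D: "dominating D" "dominating_number = |D|"
    by (rule dominating_number_witness)
  obtain R where R: "\<And>g. g \<in> D \<Longrightarrow> gap_above g (R g)"
    "\<And>A H. A \<in> \<A>' \<Longrightarrow> finite H \<Longrightarrow> H \<subseteq> D \<Longrightarrow> infinite (A \<inter> \<Inter>(R ` H))"
    using generic_gap_sets[OF eq D(2) \<A>'_small \<A>'_inf] by blast

  \<comment> \<open>Three kinds of closed constraints: agreement with \<open>\<mu>\<close>, full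
    measure of the gap sets, and smallness of the colour classes modulo powers of 2.\<close>
  define k1 where "k1 B = (B, {\<mu> B})" for B
  define k2 where "k2 g = (R g, {\<mu> UNIV})" for g
  define k3 where "k3 t = (case t of (n, i) \<Rightarrow> ({k. c k mod 2 ^ n = i}, {0..1 / 2 ^ n :: real}))"
    for t :: "nat \<times> nat"
  define K where "K = k1 ` \<B> \<union> k2 ` D \<union> range k3"
  have "\<exists>\<nu>. \<nu> \<in> UNIV \<rightarrow> {0..1} \<and> additive UNIV \<nu> \<and> (\<forall>(A, S)\<in>K. \<nu> A \<in> S)"
  proof (rule fa_measure_compactness)
    show "closed S" if "(A, S) \<in> K" for A S
      using that by (auto simp: K_def k1_def k2_def k3_def)
    fix K' assume K': "finite K'" "K' \<subseteq> K"
    obtain \<B>0 where \<B>0: "\<B>0 \<subseteq> \<B>" "finite \<B>0" "K' \<inter> k1 ` \<B> = k1 ` \<B>0"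
      using finite_subset_image[of "K' \<inter> k1 ` \<B>" k1 \<B>] K'(1) by blast
    obtain H where H: "H \<subseteq> D" "finite H" "K' \<inter> k2 ` D = k2 ` H"
      using finite_subset_image[of "K' \<inter> k2 ` D" k2 D] K'(1) by blast
    obtain Q where Q: "finite Q" "K' \<inter> range k3 = k3 ` Q"
      using finite_subset_image[of "K' \<inter> range k3" k3 UNIV] K'(1) by blast
    define Z where "Z = \<Inter>(R ` H)"
    define N where "N = (\<Sum>t\<in>Q. fst t)"
    have Z: "infinite {k \<in> B \<inter> Z. c k = j}" if B: "B \<in> \<B>" "infinite B" for B j
    proof -
      obtain A where A: "A \<in> \<A>" "A \<subseteq> B"
        using \<A>(1) B unfolding dense_family_def by blast
      have "{k \<in> A. c k = j} \<in> \<A>'"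
        unfolding \<A>'_def using A(1) by (intro image_eqI[of _ _ "(A, j)"]) auto
      then have "infinite ({k \<in> A. c k = j} \<inter> Z)"
        unfolding Z_def using H by (intro R(2))
      moreover have "{k \<in> A. c k = j} \<inter> Z \<subseteq> {k \<in> B \<inter> Z. c k = j}"
        using A(2) by blast
      ultimately show ?thesis using finite_subset by blast
    qed
    have "\<exists>\<nu>. \<nu> \<in> UNIV \<rightarrow> {0..1} \<and> additive UNIV \<nu> \<and> (\<forall>B\<in>\<B>0. \<nu> B = \<mu> B) \<and>
      (\<forall>X. Z \<subseteq> X \<longrightarrow> \<nu> X = \<mu> UNIV) \<and>
      (\<forall>n\<le>N. \<forall>i. \<nu> {k. c k mod 2 ^ n = i} \<le> 1 / 2 ^ n)"
      by (rule fa_measure_finite_approximation[OF alg \<mu> \<B>0(2,1) Z])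
    then obtain \<nu> where \<nu>: "\<nu> \<in> UNIV \<rightarrow> {0..1}" "additive UNIV \<nu>" "\<forall>B\<in>\<B>0. \<nu> B = \<mu> B"
      "\<forall>X. Z \<subseteq> X \<longrightarrow> \<nu> X = \<mu> UNIV"
      "\<forall>n\<le>N. \<forall>i. \<nu> {k. c k mod 2 ^ n = i} \<le> 1 / 2 ^ n"
      by blast
    have "\<nu> (fst t) \<in> snd t" if t: "t \<in> K'" for t
    proof -
      consider "t \<in> k1 ` \<B>0" | "t \<in> k2 ` H" | "t \<in> k3 ` Q"
      proof -
        have "t \<in> K' \<inter> k1 ` \<B> \<union> K' \<inter> k2 ` D \<union> K' \<inter> range k3"
          using K'(2) t unfolding K_def by blast
        then show ?thesis
          unfolding \<B>0(3) H(3) Q(2) using that by blast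
      qed
      then show ?thesis
      proof cases
        case 1
        then show ?thesis using \<nu>(3) by (auto simp: k1_def)
      next
        case 2
        then obtain g where "g \<in> H" "t = k2 g" by blast
        moreover from this have "Z \<subseteq> R g" by (auto simp: Z_def)
        ultimately show ?thesis using \<nu>(4) by (simp add: k2_def)
      next
        case 3
        then obtain n i where ni: "(n, i) \<in> Q" "t = k3 (n, i)" by auto
        then have "n \<le> N"
          using member_le_sum[of "(n, i)" Q fst] Q(1) by (simp add: N_def)
        then show ?thesis using \<nu>(1,5) ni(2) by (auto simp: k3_def Pi_iff)
      qed
    qed
    then show "\<exists>\<nu>. \<nu> \<in> UNIV \<rightarrow> {0..1} \<and> additive UNIV \<nu> \<and> (\<forall>(A, S)\<in>K'. \<nu> A \<in> S)"
      using \<nu>(1,2) by (intro exI[of _ \<nu>]) (auto simp: case_prod_unfold)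
  qed
  then obtain \<nu> where \<nu>: "\<nu> \<in> UNIV \<rightarrow> {0..1}" "additive UNIV \<nu>"
    "\<And>t. t \<in> K \<Longrightarrow> \<nu> (fst t) \<in> snd t"
    by (auto simp: case_prod_unfold)
  have ext: "\<nu> B = \<mu> B" if "B \<in> \<B>" for B
    using \<nu>(3)[of "k1 B"] that by (simp add: K_def k1_def)
  \<comment> \<open>Vanishing on finite sets is inherited from \<open>\<mu>\<close>, because
    \<open>\<B>\<close> contains them all.\<close>
  have "\<nu> F = 0" if "finite F" for F
    using ext[of F] that fin \<mu> by (auto simp: fa_measure_on_def)
  then have fa: "fa_measure_on UNIV \<nu>"
    using \<nu>(1,2) by (simp add: fa_measure_on_def)
  have "UNIV \<in> \<B>"
    using alg by (metis algebra.axioms(1) algebra_iff_Un double_diff Diff_empty order_refl)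
  then have "\<nu> (R g) = \<nu> UNIV" if "g \<in> D" for g
    using \<nu>(3)[of "k2 g"] ext[of UNIV] that by (simp add: K_def k2_def)
  then have "strong_Q_measure \<nu>"
    using R(1) by (intro strong_Q_measure_if_gap_sets[OF fa D(1), of R]) blast
  moreover have "\<nu> {k. c k mod 2 ^ n = i} \<le> 1 / 2 ^ n" for n i
  proof -
    have "k3 (n, i) \<in> K" by (simp add: K_def)
    from \<nu>(3)[OF this] show ?thesis by (simp add: k3_def)
  qed
  then have "atomless \<nu>"
    by (rule atomless_if_small_partitions[OF fa])
  ultimately show ?thesis using ext by blast
qed

section \<open>The converse direction and the equivalence\<close>

text \<open>The algebra generated by the filter base and the finite sets has fewer than
  \<open>dominating_number\<close> members, hence small density. Its measure is 1 on the base, which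
  no selector of full measure can respect.\<close>

lemma no_strong_Q_extension:
  assumes small: "cov_meager <o dominating_number"
  shows "\<exists>(\<B> :: nat set set) \<mu>. algebra UNIV \<B> \<and> {F. finite F} \<subseteq> \<B> \<and> fa_measure_on \<B> \<mu> \<and>
    algebra_density \<B> <o dominating_number \<and>
    \<not> (\<exists>\<nu>. strong_Q_measure \<nu> \<and> (\<forall>B\<in>\<B>. \<nu> B = \<mu> B))"
proof -
  obtain \<G> :: "nat set set" and P :: "nat \<Rightarrow> nat set" where \<G>: "|\<G>| <o dominating_number"
    "\<And>H. H \<subseteq> \<G> \<Longrightarrow> finite H \<Longrightarrow> infinite (\<Inter>H)"
    and P: "partition_on UNIV (range P)" "\<And>n. finite (P n)"
    "\<And>A. (\<And>n. card (A \<inter> P n) \<le> 1) \<Longrightarrow> \<exists>B\<in>\<G>. finite (A \<inter> B)"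
    by (rule small_cov_meager_filter_base[OF small]) blast
  obtain \<mu> where \<mu>: "fa_measure_on UNIV \<mu>" "\<And>B. B \<in> \<G> \<Longrightarrow> \<mu> B = 1"
    using fa_measure_of_filter_base[OF \<G>(2)] by blast
  define \<B> where "\<B> = binary_closure (\<lambda>X Y. - (X \<inter> Y)) (\<G> \<union> {F. finite F})"
  have \<B>: "algebra UNIV \<B>"
    unfolding \<B>_def by (rule algebra_binary_closure) simp
  have sub: "\<G> \<union> {F. finite F} \<subseteq> \<B>"
    unfolding \<B>_def by (auto intro: binary_closure.base)
  have "|{F :: nat set. finite F}| \<le>o |UNIV :: nat set|"
    using countable_Collect_finite[where 'a = nat] by (auto simp: countable_def card_of_ordLeq[symmetric])
  then have "|{F :: nat set. finite F}| <o dominating_number"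
    using nat_less_dominating_number by (rule ordLeq_ordLess_trans)
  then have "|\<B>| <o dominating_number"
    unfolding \<B>_def using \<G>(1)
    by (intro binary_closure_less_dominating_number Un_less_dominating_number)
  then have dens: "algebra_density \<B> <o dominating_number"
    by (rule ordLeq_ordLess_trans[OF algebra_density_le])
  have "\<not> (strong_Q_measure \<nu> \<and> (\<forall>B\<in>\<B>. \<nu> B = \<mu> B))" for \<nu>
  proof
    assume "strong_Q_measure \<nu> \<and> (\<forall>B\<in>\<B>. \<nu> B = \<mu> B)"
    then have \<nu>: "fa_measure_on UNIV \<nu>" "strong_Q_measure \<nu>" and ext: "\<And>B. B \<in> \<B> \<Longrightarrow> \<nu> B = \<mu> B"
      by (auto simp: strong_Q_measure_def)
    obtain A where A: "\<nu> UNIV \<le> \<nu> A" "\<And>n. card (A \<inter> P n) \<le> 1"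
      using \<nu>(2) P(1,2) unfolding strong_Q_measure_def by blast
    obtain B where B: "B \<in> \<G>" "finite (A \<inter> B)"
      using P(3)[OF A(2)] by blast
    have add: "\<nu> (X \<union> Y) = \<nu> X + \<nu> Y" if "X \<inter> Y = {}" for X Y
      using \<nu>(1) that by (auto simp: fa_measure_on_def additive_def)
    have bounds: "0 \<le> \<nu> X" "\<nu> X \<le> 1" for X
      using \<nu>(1) by (auto simp: fa_measure_on_def)
    have "\<nu> B = 1" using ext[of B] \<mu>(2) B(1) sub by auto
    have "A \<inter> B \<union> (B - A) = B" by blast
    then have "\<nu> B = \<nu> (A \<inter> B) + \<nu> (B - A)"
      using add[of "A \<inter> B" "B - A"] by auto
    moreover have "\<nu> (A \<inter> B) = 0"
      using B(2) \<nu>(1) by (simp add: fa_measure_on_def)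
    \<comment> \<open>Both summands are at least 1:
      \<open>\<nu> A \<ge> \<nu> UNIV \<ge> \<nu> B = 1\<close>, and \<open>B - A\<close> differs
      from \<open>B\<close> by a finite set. The total exceeds the bound 1.\<close>
    moreover have "\<nu> (A \<union> (B - A)) = \<nu> A + \<nu> (B - A)"
      by (rule add) auto
    moreover have "\<nu> UNIV = \<nu> B + \<nu> (- B)"
      using add[of B "- B"] by simp
    ultimately show False
      using \<open>\<nu> B = 1\<close> A(1) bounds(1)[of "- B"] bounds(2)[of "A \<union> (B - A)"] by linarith
  qed
  moreover have "fa_measure_on \<B> \<mu>"
    using \<mu>(1) by (auto simp: fa_measure_on_def additive_def)
  ultimately show ?thesis
    using \<B> sub dens by blast
qed

theorem theorem3p1:
  shows "dominating_number =o cov_meager \<longleftrightarrow>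
    (\<forall>(\<B> :: nat set set) (\<mu> :: nat set \<Rightarrow> real).
       algebra UNIV \<B> \<and> {F. finite F} \<subseteq> \<B> \<and> fa_measure_on \<B> \<mu> \<and>
       algebra_density \<B> <o dominating_number \<longrightarrow>
       (\<exists>\<nu> :: nat set \<Rightarrow> real.
          atomless \<nu> \<and> strong_Q_measure \<nu> \<and> (\<forall>B\<in>\<B>. \<nu> B = \<mu> B)))"
proof
  assume "dominating_number =o cov_meager"
  then show "\<forall>(\<B> :: nat set set) (\<mu> :: nat set \<Rightarrow> real).
       algebra UNIV \<B> \<and> {F. finite F} \<subseteq> \<B> \<and> fa_measure_on \<B> \<mu> \<and>
       algebra_density \<B> <o dominating_number \<longrightarrow>
       (\<exists>\<nu> :: nat set \<Rightarrow> real.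
          atomless \<nu> \<and> strong_Q_measure \<nu> \<and> (\<forall>B\<in>\<B>. \<nu> B = \<mu> B))"
    by (intro allI impI strong_Q_extension) auto
next
  assume *: "\<forall>(\<B> :: nat set set) (\<mu> :: nat set \<Rightarrow> real).
       algebra UNIV \<B> \<and> {F. finite F} \<subseteq> \<B> \<and> fa_measure_on \<B> \<mu> \<and>
       algebra_density \<B> <o dominating_number \<longrightarrow>
       (\<exists>\<nu> :: nat set \<Rightarrow> real.
          atomless \<nu> \<and> strong_Q_measure \<nu> \<and> (\<forall>B\<in>\<B>. \<nu> B = \<mu> B))"
  then have "\<not> cov_meager <o dominating_number"
    using no_strong_Q_extension by meson
  \<comment> \<open>As \<open>cov_meager\<close> never exceeds \<open>dominating_number\<close>,
    excluding strict inequality leaves equality.\<close>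
  then show "dominating_number =o cov_meager"
    using cov_meager_le_dominating_number ordLeq_iff_ordLess_or_ordIso ordIso_symmetric by blast
qed

end
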